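(* Let $G$ be a planar graph. Then $G$ is DPG-$[5,2]$-colorable. In particular: (1) $G$ is $5$-choosable. (2) $G$ is DP-$5$-colorable. (3) If $L$ is a $4$-assignment of $G$ and $i,j,l$ are three colors, then $G$ has an $L$-forested-coloring in which $C(i)$, $C(j)$ and $C(l)$ are independent sets. (4) If $L$ is a $3$-assignment of $G$ and $i$ is a color, then $G$ has an $L$-forested-coloring in which $C(i)$ is an independent set. (5) $G$ is DP-vertex-$3$-arborable. (6) For every $s\ge 1$ and all functions $f_1,\dots,f_s:V(G)\to\{0,1,2\}$ with $f_1(v)+\cdots+f_s(v)\ge 5$ for every vertex $v$, $G$ has an $(f_1,\dots,f_s)$-partition.
   Context: All graphs are finite, simple and undirected. An assignment $L$ of $G$ gives each vertex $v$ a set $L(v)$ of colors (colors are positive integers); it is a $k$-assignment if $|L(v)|=k$ for all $v$. $G$ is $k$-choosable if for every $k$-assignment $L$ there is a proper coloring $c$ with $c(v)\in L(v)$. A cover $H$ of $G$ with respect to $L$ is a graph with vertex set $\{(u,c):u\in V(G),c\in L(u)\}$ such that each set $\{u\}\times L(u)$ induces a complete graph, for each edge $uv$ of $G$ the edges of $H$ between $\{u\}\times L(u)$ and $\{v\}\times L(v)$ form a (possibly empty) matching, and there are no edges of $H$ between $\{u\}\times L(u)$ and $\{v\}\times L(v)$ when $uv\notin E(G)$. A representative set of $(G,H)$ is a set containing exactly one vertex of each $\{v\}\times L(v)$. A DP-coloring is a representative set $R$ with $H[R]$ edgeless; $G$ is DP-$k$-colorable if $(G,H)$ has a DP-coloring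 for every $k$-assignment $L$ and every cover $H$ with respect to $L$. A DP-forested-coloring is a representative set $R$ with $H[R]$ a forest; $G$ is DP-vertex-$k$-arborable if $(G,H)$ has a DP-forested-coloring for every $k$-assignment and every cover. An $L$-forested-coloring is a choice $c(v)\in L(v)$ for all $v$ such that for each color the set of vertices receiving it induces a forest; $C(i)$ denotes the set of vertices colored $i$. For $F=(f_1,\dots,f_s)$ with $f_i:V(G)\to\mathbb{Z}_{\ge0}$, write $|f(v)|=f_1(v)+\cdots+f_s(v)$. For a cover $H$ with respect to an assignment with lists contained in $\{1,\dots,s\}$, a DP-$F$-coloring of $(G,H)$ is a representative set $R$ that can be ordered so that each $(v,i)\in R$ has fewer than $f_i(v)$ neighbors in $H$ among the elements of $R$ preceding it (a strictly $F$-degenerate order). $G$ is DPG-$[k,t]$-colorable if for every $s\ge1$, every cover $H$ of $G$ with respect to the assignment $L(v)=\{1,\dots,s\}$ for all $v$, and every $F=(f_1,\dots,f_s)$ with $|f(v)|\ge k$ and $f_i(v)\le t$ for all $v$ and $i$, $(G,H)$ has a DP-$F$-coloring. A graph is strictly $f$-degenerate if its vertices can be ordered so that each vertex $v$ has fewer than $f(v)$ neighbors preceding it. An $(f_1,\dots,f_s)$-partition of $G$ is a partition $V(G)=V_1\cup\cdots\cup V_s$ such that $G[V_i]$ is strictly $f_i$-degenerate for each $i$. *)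

theory Defs
  imports "HOL-Analysis.Analysis"
begin

definition simple_graph :: "'a set \<Rightarrow> 'a set set \<Rightarrow> bool" where
  "simple_graph V E \<longleftrightarrow> finite V \<and>
     (\<forall>e\<in>E. \<exists>u v. e = {u, v} \<and> u \<noteq> v \<and> u \<in> V \<and> v \<in> V)"

definition planar_embedding ::
  "'a set \<Rightarrow> 'a set set \<Rightarrow> ('a \<Rightarrow> complex) \<Rightarrow> ('a set \<Rightarrow> real \<Rightarrow> complex) \<Rightarrow> bool" where
  "planar_embedding V E p \<gamma> \<longleftrightarrow>
     inj_on p V \<and>
     (\<forall>u v. {u, v} \<in> E \<longrightarrow> arc (\<gamma> {u, v}) \<and>
        {pathstart (\<gamma> {u, v}), pathfinish (\<gamma> {u, v})} = {p u, p v}) \<and>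
     (\<forall>e\<in>E. path_image (\<gamma> e) \<inter> p ` V = p ` e) \<and>
     (\<forall>e\<in>E. \<forall>e'\<in>E. e \<noteq> e' \<longrightarrow> path_image (\<gamma> e) \<inter> path_image (\<gamma> e') \<subseteq> p ` (e \<inter> e'))"

definition planar_graph :: "'a set \<Rightarrow> 'a set set \<Rightarrow> bool" where
  "planar_graph V E \<longleftrightarrow> simple_graph V E \<and> (\<exists>p \<gamma>. planar_embedding V E p \<gamma>)"

definition induces_forest :: "'b set set \<Rightarrow> 'b set \<Rightarrow> bool" where
  "induces_forest E W \<longleftrightarrow>
     \<not> (\<exists>cs. length cs \<ge> 3 \<and> distinct cs \<and> set cs \<subseteq> W \<and>
            (\<forall>k < length cs. {cs ! k, cs ! ((k + 1) mod length cs)} \<in> E))"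

definition independent_set :: "'b set set \<Rightarrow> 'b set \<Rightarrow> bool" where
  "independent_set E W \<longleftrightarrow> (\<forall>u\<in>W. \<forall>v\<in>W. {u, v} \<notin> E)"

definition strictly_degenerate :: "'b set set \<Rightarrow> 'b set \<Rightarrow> ('b \<Rightarrow> nat) \<Rightarrow> bool" where
  "strictly_degenerate E W f \<longleftrightarrow>
     (\<exists>xs. distinct xs \<and> set xs = W \<and>
        (\<forall>k < length xs. card {j. j < k \<and> {xs ! j, xs ! k} \<in> E} < f (xs ! k)))"

definition k_assignment :: "'a set \<Rightarrow> nat \<Rightarrow> ('a \<Rightarrow> nat set) \<Rightarrow> bool" where
  "k_assignment V k L \<longleftrightarrow> (\<forall>v\<in>V. finite (L v) \<and> card (L v) = k \<and> 0 \<notin> L v)"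

definition proper_L_coloring ::
  "'a set \<Rightarrow> 'a set set \<Rightarrow> ('a \<Rightarrow> nat set) \<Rightarrow> ('a \<Rightarrow> nat) \<Rightarrow> bool" where
  "proper_L_coloring V E L c \<longleftrightarrow>
     (\<forall>v\<in>V. c v \<in> L v) \<and> (\<forall>u\<in>V. \<forall>v\<in>V. {u, v} \<in> E \<longrightarrow> c u \<noteq> c v)"

definition choosable :: "'a set \<Rightarrow> 'a set set \<Rightarrow> nat \<Rightarrow> bool" where
  "choosable V E k \<longleftrightarrow> (\<forall>L. k_assignment V k L \<longrightarrow> (\<exists>c. proper_L_coloring V E L c))"

definition color_class :: "'a set \<Rightarrow> ('a \<Rightarrow> nat) \<Rightarrow> nat \<Rightarrow> 'a set" where
  "color_class V c i = {v\<in>V. c v = i}"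

definition L_forested_coloring ::
  "'a set \<Rightarrow> 'a set set \<Rightarrow> ('a \<Rightarrow> nat set) \<Rightarrow> ('a \<Rightarrow> nat) \<Rightarrow> bool" where
  "L_forested_coloring V E L c \<longleftrightarrow>
     (\<forall>v\<in>V. c v \<in> L v) \<and> (\<forall>i. induces_forest E (color_class V c i))"

text \<open>A cover H (given by its edge set HE) of G with respect to L; the vertex set of
  H is the set of pairs (u,c) with u in V and c in L u.\<close>
definition is_cover ::
  "'a set \<Rightarrow> 'a set set \<Rightarrow> ('a \<Rightarrow> nat set) \<Rightarrow> ('a \<times> nat) set set \<Rightarrow> bool" where
  "is_cover V E L HE \<longleftrightarrow>
     (\<forall>e\<in>HE. \<exists>x y. e = {x, y} \<and> x \<noteq> y \<and> x \<in> Sigma V L \<and> y \<in> Sigma V L) \<and>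
     (\<forall>u\<in>V. \<forall>c\<in>L u. \<forall>d\<in>L u. c \<noteq> d \<longrightarrow> {(u, c), (u, d)} \<in> HE) \<and>
     (\<forall>u\<in>V. \<forall>v\<in>V. {u, v} \<in> E \<longrightarrow>
        (\<forall>c\<in>L u. \<forall>d1\<in>L v. \<forall>d2\<in>L v.
           {(u, c), (v, d1)} \<in> HE \<longrightarrow> {(u, c), (v, d2)} \<in> HE \<longrightarrow> d1 = d2)) \<and>
     (\<forall>u\<in>V. \<forall>v\<in>V. \<forall>c d. u \<noteq> v \<longrightarrow> {(u, c), (v, d)} \<in> HE \<longrightarrow> {u, v} \<in> E)"

definition representative_set ::
  "'a set \<Rightarrow> ('a \<Rightarrow> nat set) \<Rightarrow> ('a \<times> nat) set \<Rightarrow> bool" where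
  "representative_set V L R \<longleftrightarrow> R \<subseteq> Sigma V L \<and> (\<forall>v\<in>V. \<exists>!c. (v, c) \<in> R)"

definition DP_coloring ::
  "'a set \<Rightarrow> ('a \<Rightarrow> nat set) \<Rightarrow> ('a \<times> nat) set set \<Rightarrow> ('a \<times> nat) set \<Rightarrow> bool" where
  "DP_coloring V L HE R \<longleftrightarrow> representative_set V L R \<and> independent_set HE R"

definition DP_k_colorable :: "'a set \<Rightarrow> 'a set set \<Rightarrow> nat \<Rightarrow> bool" where
  "DP_k_colorable V E k \<longleftrightarrow>
     (\<forall>L HE. k_assignment V k L \<longrightarrow> is_cover V E L HE \<longrightarrow> (\<exists>R. DP_coloring V L HE R))"

definition DP_forested_coloring ::
  "'a set \<Rightarrow> ('a \<Rightarrow> nat set) \<Rightarrow> ('a \<times> nat) set set \<Rightarrow> ('a \<times> nat) set \<Rightarrow> bool" where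
  "DP_forested_coloring V L HE R \<longleftrightarrow> representative_set V L R \<and> induces_forest HE R"

definition DP_vertex_arborable :: "'a set \<Rightarrow> 'a set set \<Rightarrow> nat \<Rightarrow> bool" where
  "DP_vertex_arborable V E k \<longleftrightarrow>
     (\<forall>L HE. k_assignment V k L \<longrightarrow> is_cover V E L HE \<longrightarrow> (\<exists>R. DP_forested_coloring V L HE R))"

definition DP_F_coloring ::
  "'a set \<Rightarrow> ('a \<Rightarrow> nat set) \<Rightarrow> ('a \<times> nat) set set \<Rightarrow> (nat \<Rightarrow> 'a \<Rightarrow> nat) \<Rightarrow> ('a \<times> nat) set \<Rightarrow> bool" where
  "DP_F_coloring V L HE F R \<longleftrightarrow> representative_set V L R \<and>
     (\<exists>xs. distinct xs \<and> set xs = R \<and>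
        (\<forall>k < length xs. card {j. j < k \<and> {xs ! j, xs ! k} \<in> HE}
                          < F (snd (xs ! k)) (fst (xs ! k))))"

definition DPG_colorable :: "'a set \<Rightarrow> 'a set set \<Rightarrow> nat \<Rightarrow> nat \<Rightarrow> bool" where
  "DPG_colorable V E k t \<longleftrightarrow>
     (\<forall>s::nat. s \<ge> 1 \<longrightarrow> (\<forall>HE F. is_cover V E (\<lambda>v. {1..s}) HE \<longrightarrow>
        (\<forall>v\<in>V. (\<Sum>i=1..s. F i v) \<ge> k) \<longrightarrow>
        (\<forall>v\<in>V. \<forall>i\<in>{1..s}. F i v \<le> t) \<longrightarrow>
        (\<exists>R. DP_F_coloring V (\<lambda>v. {1..s}) HE F R)))"

definition has_F_partition :: "'a set \<Rightarrow> 'a set set \<Rightarrow> nat \<Rightarrow> (nat \<Rightarrow> 'a \<Rightarrow> nat) \<Rightarrow> bool" where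
  "has_F_partition V E s F \<longleftrightarrow>
     (\<exists>part. (\<forall>v\<in>V. part v \<in> {1..s}) \<and>
        (\<forall>i\<in>{1..s}. strictly_degenerate E {v\<in>V. part v = i} (F i)))"

end

theory Submission
  imports Defs
begin

text \<open>Thomassen's induction for 5-choosability, carried out on minors instead of near-triangulations.
  The outer face is replaced by a connected vertex set Z: the outer vertices of G are those with a
  neighbour in Z, and they have total weight at least 3, all others at least 5. At most two adjacent outer
  vertices (the set X) are coloured beforehand. If a clique of at most two outer vertices separates G, both
  sides are coloured one after the other; otherwise an outer vertex v with few outer neighbours is merged into Z,
  its inner neighbours give up the weight that clashes with (at most) two units of weight reserved at v,
  and v is coloured first or last.

  The vertex v is a leaf of the graph induced by the outer vertices other than a chosen x in X. This graph has no
  cycle D: let K be the component of x in G - D. If the attachments of K on D include two nonadjacent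
  vertices a and b, then a, b, Z against K and the two arcs of D is a K33 minor; otherwise the attachments form
  a clique, which either separates G or yields with K and Z a K5 minor.

  That a planar drawing has no such minors follows from a theorem on theta curves: a connected set
  disjoint from a theta curve cannot touch the inner parts of all three arcs.\<close>

subsection \<open>Arcs and theta curves in the plane\<close>

text \<open>All that is used of the drawing is that Z can be thought of as contracted to a point:
  the outer vertices then behave like the boundary of one face. That boundary may still be a cycle,
  which is why x is deleted before a leaf is sought. The constants fit together at v. Its inner
  neighbours become outer when v joins Z, so they may fall from 5 to 3, and two units can be
  reserved. Its outer neighbours may already be at 3 and must lose nothing. If v has an uncoloured
  outer neighbour w, then at most one member of X is adjacent to v, which leaves two units of its 3.
  If these belong to two colours, at most one of them clashes with w; v takes the other and goes
  first, because one unit admits no earlier neighbour. If both belong to one colour, that colour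
  admits one earlier neighbour, namely w, and v goes last; the inner neighbours then have to avoid
  the clashing colour altogether, which costs at most 2 by the bound on the weights.\<close>

definition arc_between :: "complex set \<Rightarrow> complex \<Rightarrow> complex \<Rightarrow> bool" where
  "arc_between A a b \<longleftrightarrow> (\<exists>g. arc g \<and> path_image g = A \<and> pathstart g = a \<and> pathfinish g = b)"

lemma arc_betweenD:
  assumes "arc_between A a b"
  shows "compact A" "connected A" "path_connected A" "a \<in> A" "b \<in> A" "a \<noteq> b" "connected (A - {a, b})" 
    "A - {a, b} \<noteq> {}"
proof -
  obtain g where g: "arc g" "path_image g = A" "pathstart g = a" "pathfinish g = b"
    using assms by (auto simp: arc_between_def)
  then have s: "simple_path g" by (simp add: arc_imp_simple_path)
  show "compact A" "connected A" "path_connected A" "a \<in> A" "b \<in> A" "a \<noteq> b"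
    using g arc_distinct_ends[OF g(1)]
    by (auto simp: compact_arc_image connected_arc_image arc_imp_path path_connected_path_image)
  show "connected (A - {a, b})"
    using connected_simple_path_endless[OF s] g by simp
  show "A - {a, b} \<noteq> {}"
    using simple_path_endless[OF s] g by (auto simp: image_iff)
qed

lemma arc_between_sym: "arc_between A a b \<longleftrightarrow> arc_between A b a"
  unfolding arc_between_def by (metis arc_reversepath path_image_reversepath pathfinish_reversepath pathstart_reversepath)

lemma arc_between_join:
  assumes "arc_between A a b" "arc_between B b c" "A \<inter> B \<subseteq> {b}"
  shows "arc_between (A \<union> B) a c"
proof -
  obtain g h where "arc g" "path_image g = A" "pathstart g = a" "pathfinish g = b"
     "arc h" "path_image h = B" "pathstart h = b" "pathfinish h = c"
    using assms by (auto simp: arc_between_def)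
  with assms(3) show ?thesis
    unfolding arc_between_def
    by (intro exI[of _ "g +++ h"]) (auto simp: arc_join path_image_join)
qed

lemma arc_between_split:
  assumes "arc_between A a b" "t \<in> A" "t \<noteq> a" "t \<noteq> b"
  obtains B C where "arc_between B a t" "arc_between C t b" "B \<union> C = A" "B \<inter> C = {t}"
proof -
  obtain g where g: "arc g" "path_image g = A" "pathstart g = a" "pathfinish g = b"
    using assms by (auto simp: arc_between_def)
  obtain u where u: "u \<in> {0..1}" "g u = t"
    using assms(2) g(2) by (auto simp: path_image_def)
  have u01: "0 < u" "u < 1"
    using u assms(3,4) g(3,4) by (auto simp: pathstart_def pathfinish_def less_le)
  have *: "path_image (subpath 0 u g) = g ` {0..u}" "path_image (subpath u 1 g) = g ` {u..1}"
    using u01 by (auto simp: path_image_subpath)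
  show ?thesis
  proof
    show "arc_between (path_image (subpath 0 u g)) a t" "arc_between (path_image (subpath u 1 g)) t b"
      unfolding arc_between_def using g u u01
      by (metis arc_subpath_arc atLeastAtMost_iff less_irrefl order_refl pathfinish_def pathfinish_subpath
         pathstart_def pathstart_subpath zero_le_one)+
    show "path_image (subpath 0 u g) \<union> path_image (subpath u 1 g) = A"
      unfolding * image_Un[symmetric] using u01 g(2) by (simp add: path_image_def ivl_disj_un_two_touch)
    have "inj_on g {0..1}" using g(1) by (simp add: arc_def)
    then show "path_image (subpath 0 u g) \<inter> path_image (subpath u 1 g) = {t}"
      unfolding * using u01 u(2) by (auto simp: inj_on_def image_iff)
        (metis atLeastAtMost_iff less_eq_real_def order_trans order_antisym)
  qed
qed

lemma path_connected_arc_between: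
  assumes "path_connected (S :: complex set)" "a \<in> S" "b \<in> S" "a \<noteq> b"
  obtains A where "arc_between A a b" "A \<subseteq> S"
  using assms unfolding path_connected_arcwise arc_between_def by blast

text \<open>Legs towards a curve come from here: stopping a path at its first point in
  \<open>T\<close> makes the leg meet \<open>T\<close> in that point alone.\<close>

lemma first_hit_arc:
  fixes S T :: "complex set"
  assumes "path_connected S" "a \<in> S" "a \<notin> T" "S \<inter> T \<noteq> {}" "closed T"
  obtains A t where "arc_between A a t" "A \<subseteq> S" "A \<inter> T = {t}"
proof -
  obtain b where b: "b \<in> S" "b \<in> T" using assms(4) by blast
  obtain g where g: "path g" "path_image g \<subseteq> S" "pathstart g = a" "pathfinish g = b"
    using assms(1,2) b unfolding path_connected_def by blast
  obtain h where h: "path h" "pathstart h = a" "path_image h \<subseteq> path_image g"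
      "path_image h - {pathfinish h} \<subseteq> interior (- T)" "pathfinish h \<in> frontier (- T)"
  proof (rule exists_path_subpath_to_frontier[OF g(1), of "- T"])
    show "pathstart g \<in> closure (- T)" "pathfinish g \<notin> - T"
      using g assms(3) b closure_subset[of "- T"] by auto
  qed (use g in auto)
  have t: "pathfinish h \<in> T"
    using h(5) assms(5) by (simp add: frontier_complement) (meson closure_closed frontier_subset_closed subsetD)
  have "a \<noteq> pathfinish h" using t assms(3) by auto
  then obtain q where q: "arc q" "path_image q \<subseteq> path_image h" "pathstart q = a" "pathfinish q = pathfinish h"
    using path_contains_arc[OF h(1,2) refl] by blast
  show ?thesis
  proof
    show "arc_between (path_image q) a (pathfinish h)" using q by (auto simp: arc_between_def)
    show "path_image q \<subseteq> S" using q h g by auto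
    show "path_image q \<inter> T = {pathfinish h}"
      using q(2,4) t h(4) interior_subset[of "- T"] pathfinish_in_path_image[of q] by auto
  qed
qed

text \<open>Inside and outside are deliberately not told apart, since either side can occur in
  either role below. As each side has the whole curve in its closure, a set touching the curve can
  be continued across into the other side.\<close>

lemma Jordan_sides:
  assumes "arc_between A a b" "arc_between B a b" "A \<inter> B \<subseteq> {a, b}"
  obtains I W where "open I" "open W" "connected I" "connected W" "I \<noteq> {}" "W \<noteq> {}"
    "I \<inter> W = {}" "I \<union> W = - (A \<union> B)" "A \<union> B \<subseteq> closure I" "A \<union> B \<subseteq> closure W"
proof -
  obtain g h where g: "arc g" "path_image g = A" "pathstart g = a" "pathfinish g = b"
     and h: "arc h" "path_image h = B" "pathstart h = b" "pathfinish h = a"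
    using assms arc_between_sym unfolding arc_between_def by metis
  have "simple_path (g +++ h)"
    using g h assms(3) by (intro simple_path_join_loop) auto
  moreover have "pathfinish (g +++ h) = pathstart (g +++ h)" using g h by simp
  moreover have "path_image (g +++ h) = A \<union> B" using g h by (simp add: path_image_join)
  ultimately show ?thesis
    using Jordan_inside_outside[of "g +++ h"] that[of "inside (A \<union> B)" "outside (A \<union> B)"]
    by (auto simp: frontier_def)
qed

text \<open>Suppose that both Y and the inner part of C avoid the face U. Then Y reaches U across the point
  where it touches B without meeting \<open>A \<union> C\<close>, and across the point where it touches A without meeting
  \<open>B \<union> C\<close>. As these two sets intersect in the connected set C, Janiszewski\'s theorem says that their union
  does not separate Y from U either.\<close>

lemma theta_curve_sides:
  assumes A: "arc_between A a b" and B: "arc_between B a b" and C: "arc_between C a b"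
    and AB: "A \<inter> B \<subseteq> {a, b}"
    and U: "open U" "open W" "connected U" "U \<noteq> {}" "U \<inter> W = {}" "U \<union> W = - (A \<union> B)" "A \<union> B \<subseteq> closure U"
    and Y: "connected Y" "Y \<subseteq> W" "Y \<inter> C = {}" 
    and CW: "C - {a, b} \<subseteq> W"
    and touch: "closure Y \<inter> (A - {a, b}) \<noteq> {}" "closure Y \<inter> (B - {a, b}) \<noteq> {}"
  shows False
proof -
  note cA = arc_betweenD[OF A] and cB = arc_betweenD[OF B] and cC = arc_betweenD[OF C]
  have "Y \<noteq> {}" using touch by auto
  then obtain y u where y: "y \<in> Y" and u: "u \<in> U" using U by auto
  have reach: "connected_component (- (P \<union> C)) y u"
    if q: "q \<in> closure Y" "q \<in> closure U" "q \<notin> P" "q \<notin> C" and P: "P \<subseteq> A \<union> B" "a \<in> P" "b \<in> P" for q P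
  proof -
    have "connected (insert q Y)"
      using Y(1) by (rule connected_intermediate_closure) (use q closure_subset in auto)
    moreover have "connected (insert q U)"
      using U(3) by (rule connected_intermediate_closure) (use q closure_subset in auto)
    ultimately have "connected (insert q Y \<union> insert q U)" by (rule connected_Un) auto
    moreover have "insert q Y \<union> insert q U \<subseteq> - (P \<union> C)"
    proof -
      have "U \<inter> (A \<union> B) = {}" "W \<inter> (A \<union> B) = {}" using U(6) by auto
      moreover have "U \<inter> C = {}" using CW U(5) P \<open>U \<inter> (A \<union> B) = {}\<close> by blast
      ultimately show ?thesis using q(3,4) P(1) Y(2,3) by blast
    qed
    ultimately show ?thesis
      using y u unfolding connected_component_def by blast
  qed
  obtain p where p: "p \<in> closure Y" "p \<in> A" "p \<noteq> a" "p \<noteq> b" using touch(1) by auto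
  obtain q where q: "q \<in> closure Y" "q \<in> B" "q \<noteq> a" "q \<noteq> b" using touch(2) by auto
  have "p \<notin> C" "q \<notin> C" "p \<notin> B" "q \<notin> A" using p q AB CW U(6) by auto
  have "connected_component (- (A \<union> C)) y u"
    using q \<open>q \<notin> C\<close> \<open>q \<notin> A\<close> U(7) cA by (intro reach[of q]) auto
  moreover have "connected_component (- (B \<union> C)) y u"
    using p \<open>p \<notin> C\<close> \<open>p \<notin> B\<close> U(7) cB by (intro reach[of p]) auto
  moreover have "(A \<union> C) \<inter> (B \<union> C) = C" using AB cC by auto
  ultimately have "connected_component (- ((A \<union> C) \<union> (B \<union> C))) y u"
    using Janiszewski[of "A \<union> C" "B \<union> C" y u] cA cB cC by (auto simp: compact_imp_closed closed_Un)
  then obtain T where T: "connected T" "T \<subseteq> U \<union> W" "y \<in> T" "u \<in> T"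
    using U(6) unfolding connected_component_def by blast
  then show False
    using connectedD[OF T(1) U(1,2)] U(5) y u Y(2) by auto
qed

lemma connected_in_side:
  assumes "connected T" "T \<subseteq> I \<union> W" "open I" "open W" "I \<inter> W = {}"
  shows "T \<subseteq> I \<or> T \<subseteq> W"
  using connectedD[of T I W] assms by blast

text \<open>Touching is expressed by \<open>closure Y\<close> because Y will end in half-open legs,
  which have to stay disjoint from the arcs. Through a touching point, Y and the inner part of C
  form one connected set, so they share a side of the curve formed by A and B; the other side serves
  as U in \<open>theta_curve_sides\<close>.\<close>

lemma theta_curve_touch3:
  assumes A: "arc_between A a b" and B: "arc_between B a b" and C: "arc_between C a b"
    and int: "A \<inter> B \<subseteq> {a, b}" "A \<inter> C \<subseteq> {a, b}" "B \<inter> C \<subseteq> {a, b}"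
    and Y: "connected Y" "Y \<inter> (A \<union> B \<union> C) = {}" 
    and touch: "closure Y \<inter> (A - {a, b}) \<noteq> {}" "closure Y \<inter> (B - {a, b}) \<noteq> {}" "closure Y \<inter> (C - {a, b}) \<noteq> {}"
  shows False
proof -
  obtain I W where UW: "open I" "open W" "connected I" "connected W" "I \<noteq> {}" "W \<noteq> {}"
    "I \<inter> W = {}" "I \<union> W = - (A \<union> B)" "A \<union> B \<subseteq> closure I" "A \<union> B \<subseteq> closure W"
    using Jordan_sides[OF A B int(1)] .
  obtain q where q: "q \<in> closure Y" "q \<in> C - {a, b}" using touch(3) by auto
  have "connected (insert q Y)"
    using Y(1) by (rule connected_intermediate_closure) (use q closure_subset in auto)
  then have "connected (insert q Y \<union> (C - {a, b}))"
    using q by (intro connected_Un arc_betweenD(7)[OF C]) auto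
  moreover have "insert q Y \<union> (C - {a, b}) \<subseteq> I \<union> W"
    using q Y(2) int unfolding UW(8) by auto
  ultimately have "insert q Y \<union> (C - {a, b}) \<subseteq> I \<or> insert q Y \<union> (C - {a, b}) \<subseteq> W"
    using connected_in_side UW by meson
  then consider "Y \<subseteq> I" "C - {a, b} \<subseteq> I" | "Y \<subseteq> W" "C - {a, b} \<subseteq> W" by blast
  then show False
  proof cases
    case 1
    show False
      by (rule theta_curve_sides[OF A B C int(1) UW(2,1,4,6) _ _ UW(10) Y(1)]) (use 1 UW(7,8) Y(2) touch in auto)
  next
    case 2
    show False
      by (rule theta_curve_sides[OF A B C int(1) UW(1,2,3,5) _ _ UW(9) Y(1)]) (use 2 UW(7,8) Y(2) touch in auto)
  qed
qed

text \<open>An arc is connected with more than one point, so none of its points is isolated and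
  deleting finitely many of them does not change the closure.\<close>

lemma arc_between_half_open:
  assumes "arc_between A a b"
  shows "connected (A - {b})" "A \<subseteq> closure (A - {b})" "A \<subseteq> closure (A - {a, b})"
proof -
  note A = arc_betweenD[OF assms]
  have lim: "x islimpt A" if "x \<in> A" for x
  proof (rule connected_imp_perfect[OF A(2) that])
    show "A \<noteq> {y}" for y using A(4,5,6) by auto
  qed
  have cl: "A \<subseteq> closure (A - F)" if "finite F" for F
  proof
    fix x assume "x \<in> A"
    have "x islimpt (A \<inter> F) \<union> (A - F)" using lim[OF \<open>x \<in> A\<close>] by (simp add: Un_commute Un_Diff_Int)
    then have "x islimpt (A - F)" using islimpt_Un_finite[of "A \<inter> F" x "A - F"] that by simp
    then show "x \<in> closure (A - F)" by (simp add: closure_def)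
  qed
  show "A \<subseteq> closure (A - {b})" "A \<subseteq> closure (A - {a, b})" by (intro cl; simp)+
  show "connected (A - {b})"
    using A(7) by (rule connected_intermediate_closure) (use cl[of "{a, b}"] in auto)
qed

text \<open>The tripod and the two arcs at c contain a theta curve with ends t and c: one arc passes
  through a, one through b, and the third is \<open>lc\<close>. Y touches them at a, b and
  q.\<close>

lemma not_touch3_tripod:
  assumes l: "arc_between la t a" "arc_between lb t b" "arc_between lc t c"
    and e: "arc_between bc b c" "arc_between ac a c"
    and disj: "la \<inter> lb \<subseteq> {t}" "la \<inter> lc \<subseteq> {t}" "lb \<inter> lc \<subseteq> {t}"
      "la \<inter> bc = {}" "lb \<inter> bc \<subseteq> {b}" "lc \<inter> bc \<subseteq> {c}"
      "la \<inter> ac \<subseteq> {a}" "lb \<inter> ac = {}" "lc \<inter> ac \<subseteq> {c}" "bc \<inter> ac \<subseteq> {c}"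
    and Y: "connected Y" "Y \<inter> (la \<union> lb \<union> lc \<union> bc \<union> ac) = {}"
      "a \<in> closure Y" "b \<in> closure Y" "q \<in> closure Y" "q \<in> lc" "q \<noteq> t" "q \<noteq> c"
  shows False
proof (rule theta_curve_touch3)
  show "arc_between (la \<union> ac) t c" "arc_between (lb \<union> bc) t c"
    using l e disj by (auto intro!: arc_between_join)
  show "arc_between lc t c" by fact
  show "connected Y" by fact
  have "a \<noteq> t" "a \<noteq> c" "b \<noteq> t" "b \<noteq> c" "a \<in> la" "b \<in> lb" using l e arc_betweenD by blast+
  then show "closure Y \<inter> (la \<union> ac - {t, c}) \<noteq> {}" "closure Y \<inter> (lb \<union> bc - {t, c}) \<noteq> {}"
    "closure Y \<inter> (lc - {t, c}) \<noteq> {}"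
    using Y by auto
qed (use disj Y(2) in auto)

text \<open>The tripod and Y stand for the two branch sets outside the triangle, and q is where they
  meet. If q is not the centre t, the leg carrying q plays the part of \<open>lc\<close> in
  \<open>not_touch3_tripod\<close>. Only q = t is a genuine K5.\<close>

lemma no_plane_K5:
  assumes l: "arc_between la t a" "arc_between lb t b" "arc_between lc t c"
    and e: "arc_between ab a b" "arc_between bc b c" "arc_between ac a c"
    and disj: "la \<inter> lb \<subseteq> {t}" "la \<inter> lc \<subseteq> {t}" "lb \<inter> lc \<subseteq> {t}"
      "la \<inter> ab \<subseteq> {a}" "lb \<inter> ab \<subseteq> {b}" "lc \<inter> ab = {}"
      "la \<inter> bc = {}" "lb \<inter> bc \<subseteq> {b}" "lc \<inter> bc \<subseteq> {c}"
      "la \<inter> ac \<subseteq> {a}" "lb \<inter> ac = {}" "lc \<inter> ac \<subseteq> {c}"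
      "ab \<inter> bc \<subseteq> {b}" "ab \<inter> ac \<subseteq> {a}" "bc \<inter> ac \<subseteq> {c}"
    and Y: "connected Y" "Y \<inter> (la \<union> lb \<union> lc \<union> ab \<union> bc \<union> ac) = {}"
      "a \<in> closure Y" "b \<in> closure Y" "c \<in> closure Y" "q \<in> closure Y"
      "q \<in> la \<union> lb \<union> lc" "q \<noteq> a" "q \<noteq> b" "q \<noteq> c"
  shows False
proof -
  have e': "arc_between ab b a" "arc_between bc c b" "arc_between ac c a"
    using e arc_between_sym by blast+
  consider "q = t" | "q \<noteq> t" "q \<in> la" | "q \<noteq> t" "q \<in> lb" | "q \<noteq> t" "q \<in> lc" using Y(7) by blast
  then show False
  proof cases
    case 2
    show False
      by (rule not_touch3_tripod[OF l(2) l(3) l(1) e'(3) e'(1), of Y q]) (use 2 disj Y in auto)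
  next
    case 3
    show False
      by (rule not_touch3_tripod[OF l(1) l(3) l(2) e'(2) e(1), of Y q]) (use 3 disj Y in auto)
  next
    case 4
    show False
      by (rule not_touch3_tripod[OF l e(2,3), of Y q]) (use 4 disj Y in auto)
  next
    case 1
    \<comment> \<open>No two of Y, ab and lc lie on the same side of the closed curve through t, a, c, b.\<close>
    have pts: "a \<in> la" "b \<in> lb" "c \<in> lc" "t \<in> la" "t \<in> lb" "t \<in> lc" "a \<in> ab" "b \<in> ab" "b \<in> bc" "c \<in> bc" "a \<in> ac" "c \<in> ac"
      "t \<noteq> a" "t \<noteq> b" "t \<noteq> c" "a \<noteq> b" "b \<noteq> c" "a \<noteq> c"
      using l e arc_betweenD by blast+
    have J: "arc_between (la \<union> ac) t c" "arc_between (lb \<union> bc) t c" "(la \<union> ac) \<inter> (lb \<union> bc) \<subseteq> {t, c}"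
      using l e disj by (auto intro!: arc_between_join)
    \<comment> \<open>The same closed curve, cut at a and b instead of t and c: now t and c are
      inner points of its two arcs, and Y touches both.\<close>
    have J': "arc_between (la \<union> lb) a b" "arc_between (ac \<union> bc) a b" "(la \<union> lb) \<inter> (ac \<union> bc) \<subseteq> {a, b}"
    proof -
      have "arc_between la a t" using l(1) arc_between_sym by blast
      then show "arc_between (la \<union> lb) a b" using l(2) disj(1) by (rule arc_between_join)
      show "arc_between (ac \<union> bc) a b" using e(3) e'(2) disj(15) by (intro arc_between_join[of _ _ c]) auto
    qed (use disj in auto)
    obtain I W where IW: "open I" "open W" "connected I" "connected W" "I \<noteq> {}" "W \<noteq> {}"
      "I \<inter> W = {}" "I \<union> W = - ((la \<union> ac) \<union> (lb \<union> bc))"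
      "(la \<union> ac) \<union> (lb \<union> bc) \<subseteq> closure I" "(la \<union> ac) \<union> (lb \<union> bc) \<subseteq> closure W"
      using Jordan_sides[OF J] .
    have WI: "W \<inter> I = {}" "W \<union> I = - ((la \<union> ac) \<union> (lb \<union> bc))" "(la \<union> lb) \<union> (ac \<union> bc) = (la \<union> ac) \<union> (lb \<union> bc)"
      using IW(7,8) by auto
    have cab: "connected (ab - {a, b})" "ab \<subseteq> closure (ab - {a, b})"
      and clc: "connected (lc - {t, c})"
      using arc_betweenD(7) arc_between_half_open(3) e(1) l(3) by auto
    have sub: "ab - {a, b} \<subseteq> I \<union> W" "lc - {t, c} \<subseteq> I \<union> W" "Y \<subseteq> I \<union> W"
    proof -
      show "ab - {a, b} \<subseteq> I \<union> W" using disj(4,5,13,14) unfolding IW(8) by blast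
      show "lc - {t, c} \<subseteq> I \<union> W" using disj(2,3,9,12) unfolding IW(8) by blast
      show "Y \<subseteq> I \<union> W" using Y(2) unfolding IW(8) by blast
    qed
    have nYlc: "\<not> (Y \<subseteq> S \<and> lc - {t, c} \<subseteq> S)" if "S = I \<or> S = W" for S
    proof
      assume S: "Y \<subseteq> S \<and> lc - {t, c} \<subseteq> S"
      have touch: "closure Y \<inter> (la \<union> ac - {t, c}) \<noteq> {}" "closure Y \<inter> (lb \<union> bc - {t, c}) \<noteq> {}" "Y \<inter> lc = {}"
        using Y(2,3,4) pts by auto
      from that show False
        using theta_curve_sides[OF J(1,2) l(3) J(3) IW(1,2,3,5,7,8,9) Y(1) _ touch(3) _ touch(1,2)]
          theta_curve_sides[OF J(1,2) l(3) J(3) IW(2,1,4,6) WI(1,2) IW(10) Y(1) _ touch(3) _ touch(1,2)] S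
        by blast
    qed
    have nablc: "\<not> (ab - {a, b} \<subseteq> S \<and> lc - {t, c} \<subseteq> S)" if "S = I \<or> S = W" for S
    proof
      assume S: "ab - {a, b} \<subseteq> S \<and> lc - {t, c} \<subseteq> S"
      have touch: "closure (ab - {a, b}) \<inter> (la \<union> ac - {t, c}) \<noteq> {}" "closure (ab - {a, b}) \<inter> (lb \<union> bc - {t, c}) \<noteq> {}"
         "(ab - {a, b}) \<inter> lc = {}"
        using cab(2) disj(6) pts by blast+
      from that show False
        using theta_curve_sides[OF J(1,2) l(3) J(3) IW(1,2,3,5,7,8,9) cab(1) _ touch(3) _ touch(1,2)]
          theta_curve_sides[OF J(1,2) l(3) J(3) IW(2,1,4,6) WI(1,2) IW(10) cab(1) _ touch(3) _ touch(1,2)] S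
        by blast
    qed
    have nYab: "\<not> (Y \<subseteq> S \<and> ab - {a, b} \<subseteq> S)" if "S = I \<or> S = W" for S
    proof
      assume S: "Y \<subseteq> S \<and> ab - {a, b} \<subseteq> S"
      have touch: "closure Y \<inter> (la \<union> lb - {a, b}) \<noteq> {}" "closure Y \<inter> (ac \<union> bc - {a, b}) \<noteq> {}" "Y \<inter> ab = {}"
        using Y(2,5,6) pts 1 by auto
      from that show False
        using theta_curve_sides[OF J'(1,2) e(1) J'(3) IW(1,2,3,5,7) _ _ Y(1) _ touch(3) _ touch(1,2)]
          theta_curve_sides[OF J'(1,2) e(1) J'(3) IW(2,1,4,6) WI(1) _ _ Y(1) _ touch(3) _ touch(1,2)] S
          IW(8,9,10) WI(2,3) by metis
    qed
    \<comment> \<open>Three connected sets and only two sides, so two of the sets share one.\<close>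
    have "Y \<subseteq> I \<or> Y \<subseteq> W" "ab - {a, b} \<subseteq> I \<or> ab - {a, b} \<subseteq> W" "lc - {t, c} \<subseteq> I \<or> lc - {t, c} \<subseteq> W"
      using connected_in_side[OF _ _ IW(1,2,7)] Y(1) cab(1) clc sub by blast+
    then show False using nYlc nablc nYab by blast
  qed
qed

subsection \<open>Excluded minors of plane drawings\<close>

text \<open>Stated by cuts rather than paths. The empty set counts as connected, which admits
  \<open>Z = {}\<close> at the start and a set \<open>G - Q\<close> with nothing left.\<close>

definition connected_set :: "'a set set \<Rightarrow> 'a set \<Rightarrow> bool" where
  "connected_set E U \<longleftrightarrow> (\<forall>A. A \<subseteq> U \<longrightarrow> A \<noteq> {} \<longrightarrow> A \<noteq> U \<longrightarrow> (\<exists>a\<in>A. \<exists>b\<in>U - A. {a, b} \<in> E))"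

definition joined :: "'a set set \<Rightarrow> 'a set \<Rightarrow> 'a set \<Rightarrow> bool" where
  "joined E A B \<longleftrightarrow> (\<exists>a\<in>A. \<exists>b\<in>B. {a, b} \<in> E)"

lemma joined_sym: "joined E A B \<longleftrightarrow> joined E B A"
  unfolding joined_def by (metis insert_commute)

lemma simple_graph_edge: "simple_graph V E \<Longrightarrow> {u, v} \<in> E \<Longrightarrow> u \<noteq> v \<and> u \<in> V \<and> v \<in> V"
  unfolding simple_graph_def by (metis doubleton_eq_iff insert_absorb2)

lemma simple_graph_loopfree: "simple_graph V E \<Longrightarrow> {v} \<notin> E"
  using simple_graph_edge[of V E v v] by auto

locale plane_drawing =
  fixes V :: "'a set" and E :: "'a set set" and p :: "'a \<Rightarrow> complex" and \<gamma> :: "'a set \<Rightarrow> real \<Rightarrow> complex"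
  assumes simple: "simple_graph V E" and embedding: "planar_embedding V E p \<gamma>"
begin

abbreviation line :: "'a set \<Rightarrow> complex set" where
  "line e \<equiv> path_image (\<gamma> e)"

text \<open>Branch sets of a minor are drawn uncontracted, together with their edges to the vertices in Q.\<close>

definition star :: "'a set \<Rightarrow> 'a set \<Rightarrow> complex set" where
  "star K Q = p ` K \<union> (\<Union>e\<in>{e\<in>E. e \<subseteq> K \<union> Q \<and> e \<inter> K \<noteq> {}}. line e)"

lemma edgeE:
  assumes "e \<in> E" obtains u v where "e = {u, v}" "u \<noteq> v" "u \<in> V" "v \<in> V"
  using assms simple unfolding simple_graph_def by meson

lemma edge_in_V: "e \<in> E \<Longrightarrow> e \<subseteq> V"
  by (elim edgeE) simp

lemma p_inj: "u \<in> V \<Longrightarrow> v \<in> V \<Longrightarrow> p u = p v \<longleftrightarrow> u = v"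
  using embedding unfolding planar_embedding_def by (elim conjE) (rule inj_on_eq_iff)

lemma line_arc:
  assumes "{u, v} \<in> E" shows "arc_between (line {u, v}) (p u) (p v)"
proof -
  have "\<forall>u v. {u, v} \<in> E \<longrightarrow> arc (\<gamma> {u, v}) \<and> {pathstart (\<gamma> {u, v}), pathfinish (\<gamma> {u, v})} = {p u, p v}"
    using embedding unfolding planar_embedding_def by (elim conjE)
  with assms have "arc (\<gamma> {u, v})" "{pathstart (\<gamma> {u, v}), pathfinish (\<gamma> {u, v})} = {p u, p v}"
    by simp_all
  then have "arc_between (line {u, v}) (p u) (p v) \<or> arc_between (line {u, v}) (p v) (p u)"
    unfolding doubleton_eq_iff arc_between_def by blast
  then show ?thesis using arc_between_sym by blast
qed

lemma line_vertex:
  assumes "e \<in> E" "v \<in> V" shows "p v \<in> line e \<longleftrightarrow> v \<in> e"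
proof -
  have "line e \<inter> p ` V = p ` e"
    using embedding assms(1) unfolding planar_embedding_def by (elim conjE) (rule bspec)
  then have "p v \<in> line e \<longleftrightarrow> p v \<in> p ` e" using assms(2) by blast
  then show ?thesis using p_inj assms edge_in_V by blast
qed

lemma line_inter: "e \<in> E \<Longrightarrow> e' \<in> E \<Longrightarrow> e \<noteq> e' \<Longrightarrow> line e \<inter> line e' \<subseteq> p ` (e \<inter> e')"
  using embedding unfolding planar_embedding_def by (elim conjE) simp

text \<open>No edge is drawn in both stars: it would have an end in K, which is disjoint from L and
  R. So the two drawings can meet only in attachment vertices that they share.\<close>

lemma star_inter:
  assumes "K \<subseteq> V" "L \<subseteq> V" "K \<inter> L = {}" "K \<inter> R = {}" "L \<inter> Q = {}"
  shows "star K Q \<inter> star L R \<subseteq> p ` (Q \<inter> R)"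
proof
  fix x assume x: "x \<in> star K Q \<inter> star L R"
  consider (vv) u v where "u \<in> K" "v \<in> L" "x = p u" "x = p v"
    | (ve) u e where "u \<in> K" "x = p u" "e \<in> E" "e \<subseteq> L \<union> R" "x \<in> line e"
    | (ev) v e where "v \<in> L" "x = p v" "e \<in> E" "e \<subseteq> K \<union> Q" "x \<in> line e"
    | (ee) e e' where "e \<in> E" "e \<subseteq> K \<union> Q" "e \<inter> K \<noteq> {}" "x \<in> line e" "e' \<in> E" "e' \<subseteq> L \<union> R" "x \<in> line e'"
    using x unfolding star_def by blast
  then show "x \<in> p ` (Q \<inter> R)"
  proof cases
    case vv then show ?thesis using assms p_inj by blast
  next
    case ve then show ?thesis using assms line_vertex[of e u] by blast
  next
    case ev then show ?thesis using assms line_vertex[of e v] by blast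
  next
    case ee
    then have "e \<noteq> e'" using assms by blast
    then have "x \<in> p ` (e \<inter> e')" using line_inter ee by blast
    then show ?thesis using ee assms by blast
  qed
qed

lemma star_line_inter:
  assumes "K \<subseteq> V" "e \<in> E" "e \<inter> K = {}"
  shows "star K Q \<inter> line e \<subseteq> p ` (Q \<inter> e)"
proof
  fix x assume x: "x \<in> star K Q \<inter> line e"
  then consider (v) u where "u \<in> K" "x = p u" | (e) e' where "e' \<in> E" "e' \<subseteq> K \<union> Q" "e' \<inter> K \<noteq> {}" "x \<in> line e'"
    unfolding star_def by blast
  then show "x \<in> p ` (Q \<inter> e)"
  proof cases
    case v then show ?thesis using x assms line_vertex[of e u] by blast
  next
    case e
    then have "x \<in> p ` (e' \<inter> e)" using line_inter[of e' e] x assms by blast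
    then show ?thesis using e assms by blast
  qed
qed

lemma star_vertex:
  assumes "K \<subseteq> V" "v \<in> V" "v \<notin> K" "p v \<in> star K Q" shows "v \<in> Q"
  using assms p_inj line_vertex unfolding star_def by blast

lemma star_path_connected:
  assumes K: "K \<subseteq> V" "connected_set E K"
  shows "path_connected (star K Q)"
proof (cases "K = {}")
  case False
  let ?S = "star K Q"
  obtain u where u: "u \<in> K" using False by blast
  have pS: "p v \<in> ?S" if "v \<in> K" for v using that by (auto simp: star_def)
  have edge: "path_component ?S (p v) x" if "e \<in> E" "e \<subseteq> K \<union> Q" "v \<in> e" "v \<in> K" "x \<in> line e" for v x e
  proof -
    have "e \<inter> K \<noteq> {}" using that by blast
    then have "line e \<subseteq> ?S" using that by (auto simp: star_def)
    moreover have "path_connected (line e)"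
      using edgeE[OF that(1)] line_arc arc_betweenD(3) that(1) by metis
    moreover have "p v \<in> line e" using line_vertex that K by blast
    ultimately show ?thesis
      using that(5) unfolding path_connected_component by (meson path_component_of_subset)
  qed
  define A where "A = {v\<in>K. path_component ?S (p u) (p v)}"
  have "A = K"
  proof (rule ccontr)
    assume "A \<noteq> K"
    moreover have "u \<in> A" using u pS by (auto simp: A_def path_component_refl)
    ultimately obtain a b where ab: "a \<in> A" "b \<in> K - A" "{a, b} \<in> E"
      using K(2) unfolding connected_set_def by (metis (no_types, lifting) A_def empty_iff mem_Collect_eq subsetI)
    then have "p b \<in> line {a, b}" using line_vertex K by blast
    then have "path_component ?S (p a) (p b)"
      using ab by (intro edge[of "{a, b}"]) (auto simp: A_def)
    then show False using ab path_component_trans by (auto simp: A_def)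
  qed
  have "path_component ?S (p u) x" if x: "x \<in> ?S" for x
  proof -
    consider v where "v \<in> K" "x = p v" | e v where "e \<in> E" "e \<subseteq> K \<union> Q" "v \<in> e" "v \<in> K" "x \<in> line e"
      using x unfolding star_def by blast
    then show ?thesis
      using \<open>A = K\<close> edge path_component_trans unfolding A_def by cases blast+
  qed
  then show ?thesis
    unfolding path_connected_component by (meson path_component_sym path_component_trans)
qed (auto simp: star_def)

section \<open>Arcs and legs inside branch sets\<close>

lemma star_mono:
  assumes "Q \<subseteq> R" shows "star K Q \<subseteq> star K R"
proof -
  have "{e\<in>E. e \<subseteq> K \<union> Q \<and> e \<inter> K \<noteq> {}} \<subseteq> {e\<in>E. e \<subseteq> K \<union> R \<and> e \<inter> K \<noteq> {}}" using assms by blast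
  then show ?thesis unfolding star_def by blast
qed

lemma line_subset_star: "{a, k} \<in> E \<Longrightarrow> k \<in> K \<Longrightarrow> a \<in> K \<union> Q \<Longrightarrow> line {a, k} \<subseteq> star K Q"
  by (auto simp: star_def)

text \<open>That the arc really enters the uncontracted branch set gives a later leg, started from a
  third neighbour of K, a target to run to.\<close>

lemma arc_through:
  assumes K: "K \<subseteq> V" "connected_set E K" and ab: "a \<in> V - K" "b \<in> V - K" "a \<noteq> b"
    and "joined E {a} K" "joined E {b} K"
  obtains A where "arc_between A (p a) (p b)" "A \<subseteq> star K {a, b}" "A \<inter> star K {} \<noteq> {}"
proof -
  obtain k l where k: "k \<in> K" "{a, k} \<in> E" and l: "l \<in> K" "{b, l} \<in> E"
    using assms(6,7) unfolding joined_def by auto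
  have fin: "p a \<in> line {a, k}" "p k \<in> line {a, k}" "p b \<in> line {b, l}" "p l \<in> line {b, l}"
    using line_vertex k l ab K by blast+
  have pc: "path_connected (line {a, k})" "path_connected (line {b, l})" "path_connected (star K {})"
    using line_arc arc_betweenD(3) k l star_path_connected K by blast+
  have "p k \<in> star K {}" "p l \<in> star K {}" using k l by (auto simp: star_def)
  then have "path_connected ((line {a, k} \<union> star K {}) \<union> line {b, l})"
    using fin by (intro path_connected_Un pc) auto
  moreover have "p a \<noteq> p b" using ab p_inj by blast
  ultimately obtain A where A: "arc_between A (p a) (p b)" "A \<subseteq> (line {a, k} \<union> star K {}) \<union> line {b, l}"
    using fin by (elim path_connected_arc_between[of _ "p a" "p b"]) auto
  show ?thesis
  proof
    show "arc_between A (p a) (p b)" by fact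
    show "A \<subseteq> star K {a, b}"
    proof -
      have "line {a, k} \<subseteq> star K {a, b}" "line {b, l} \<subseteq> star K {a, b}" "star K {} \<subseteq> star K {a, b}"
        using k l by (simp_all add: line_subset_star star_mono)
      then show ?thesis using A(2) by blast
    qed
    \<comment> \<open>Otherwise A lies in the union of the two end lines, which meet only inside
      \<open>star K {}\<close>; being connected, A would miss one of them and thus one of its own
      end points.\<close>
    show "A \<inter> star K {} \<noteq> {}"
    proof
      assume disj: "A \<inter> star K {} = {}"
      have "line {a, k} \<inter> line {b, l} \<subseteq> p ` ({a, k} \<inter> {b, l})"
        using k l ab by (intro line_inter) (auto simp: doubleton_eq_iff)
      also have "\<dots> \<subseteq> star K {}" using ab k l by (auto simp: star_def)
      finally have "line {a, k} \<inter> line {b, l} \<inter> A = {}" using disj by blast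
      moreover have "closed (line {a, k})" "closed (line {b, l})"
        using line_arc arc_betweenD(1) k l compact_imp_closed by blast+
      moreover have "A \<subseteq> line {a, k} \<union> line {b, l}" using A(2) disj by blast
      ultimately have "line {a, k} \<inter> A = {} \<or> line {b, l} \<inter> A = {}"
        using connected_closedD[OF arc_betweenD(2)[OF A(1)]] by blast
      then show False using arc_betweenD(4,5)[OF A(1)] fin by blast
    qed
  qed
qed

text \<open>Removing \<open>t\<close> keeps the leg disjoint from T while it still touches T
  there.\<close>

lemma branch_leg:
  assumes K: "K \<subseteq> V" "connected_set E K" and z: "z \<in> V - K" "joined E {z} K"
    and T: "closed T" "p z \<notin> T" "T \<inter> star K {} \<noteq> {}"
  obtains B t where "connected (B - {t})" "p z \<in> B - {t}" "B \<subseteq> star K {z}" "B \<inter> T = {t}" "t \<in> closure (B - {t})"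
    "t \<noteq> p z"
proof -
  obtain k where k: "k \<in> K" "{z, k} \<in> E" using z unfolding joined_def by auto
  have "p z \<in> line {z, k}" using line_vertex k z by blast
  then have "p z \<in> star K {z}" using line_subset_star[of z k K "{z}"] k by auto
  moreover have "star K {z} \<inter> T \<noteq> {}" using T(3) star_mono[of "{}" "{z}" K] by blast
  ultimately obtain B t where B: "arc_between B (p z) t" "B \<subseteq> star K {z}" "B \<inter> T = {t}"
    by (rule first_hit_arc[OF star_path_connected[OF K] _ T(2) _ T(1)])
  show ?thesis
  proof (rule that[OF arc_between_half_open(1)[OF B(1)] _ B(2,3)])
    show "p z \<in> B - {t}" "t \<in> closure (B - {t})" "t \<noteq> p z"
      using arc_betweenD(4,5,6)[OF B(1)] arc_between_half_open(2)[OF B(1)] by auto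
  qed
qed

text \<open>One of the three arms of a K33: an arc of the theta curve through K, and the leg by
  which the branch set containing z touches it.\<close>

lemma K33_leg:
  assumes K: "K \<subseteq> V" "connected_set E K" and abz: "a \<in> V - K" "b \<in> V - K" "a \<noteq> b" "z \<in> V - K" "z \<noteq> a" "z \<noteq> b"
    and j: "joined E {a} K" "joined E {b} K" "joined E {z} K"
  obtains A B where "arc_between A (p a) (p b)" "A \<subseteq> star K {a, b}" "connected B" "p z \<in> B" "B \<subseteq> star K {z}"
    "B \<inter> A = {}" "closure B \<inter> (A - {p a, p b}) \<noteq> {}"
proof -
  obtain A where A: "arc_between A (p a) (p b)" "A \<subseteq> star K {a, b}" "A \<inter> star K {} \<noteq> {}"
    using arc_through[OF K abz(1-3) j(1,2)] .
  have "closed A" using arc_betweenD(1)[OF A(1)] by (rule compact_imp_closed)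
  moreover have "p z \<notin> A" using star_vertex[of K z "{a, b}"] K abz A(2) by blast
  ultimately obtain B t where B: "connected (B - {t})" "p z \<in> B - {t}" "B \<subseteq> star K {z}" "B \<inter> A = {t}"
      "t \<in> closure (B - {t})" "t \<noteq> p z"
    using branch_leg[OF K abz(4) j(3) _ _ A(3)] by metis
  \<comment> \<open>The leg stays in \<open>star K {z}\<close>, where z is the only possible vertex
    outside K; so it hits A at an inner point.\<close>
  have "t \<noteq> p a" "t \<noteq> p b"
    using star_vertex[of K a "{z}"] star_vertex[of K b "{z}"] B(3,4) K abz by blast+
  then show ?thesis
    using B by (intro that[OF A(1,2) B(1,2)]) auto
qed

text \<open>The vertices a and b are the ends of a theta curve with arcs through \<open>K1\<close>,
  \<open>K2\<close>, \<open>K3\<close>. The drawing of Z together with three legs is connected,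
  avoids the curve and touches every arc inside.\<close>

lemma no_K33_minor:
  assumes Z: "Z \<subseteq> V" "connected_set E Z" and K: "K1 \<subseteq> V" "connected_set E K1" "K2 \<subseteq> V" "connected_set E K2"
      "K3 \<subseteq> V" "connected_set E K3"
    and ab: "a \<in> V" "b \<in> V" "a \<noteq> b" "a \<notin> Z \<union> K1 \<union> K2 \<union> K3" "b \<notin> Z \<union> K1 \<union> K2 \<union> K3"
    and disj: "K1 \<inter> K2 = {}" "K1 \<inter> K3 = {}" "K2 \<inter> K3 = {}" "Z \<inter> K1 = {}" "Z \<inter> K2 = {}" "Z \<inter> K3 = {}"
    and j: "joined E {a} K1" "joined E {a} K2" "joined E {a} K3" "joined E {b} K1" "joined E {b} K2" "joined E {b} K3"
      "joined E Z K1" "joined E Z K2" "joined E Z K3"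
  shows False
proof -
  obtain z1 z2 z3 where z: "z1 \<in> Z" "joined E {z1} K1" "z2 \<in> Z" "joined E {z2} K2" "z3 \<in> Z" "joined E {z3} K3"
    using j(7-9) unfolding joined_def by blast
  have side: "a \<in> V - K1" "b \<in> V - K1" "z1 \<in> V - K1" "z1 \<noteq> a" "z1 \<noteq> b"
     "a \<in> V - K2" "b \<in> V - K2" "z2 \<in> V - K2" "z2 \<noteq> a" "z2 \<noteq> b"
     "a \<in> V - K3" "b \<in> V - K3" "z3 \<in> V - K3" "z3 \<noteq> a" "z3 \<noteq> b"
    using z ab disj Z(1) by auto
  obtain A1 B1 where 1: "arc_between A1 (p a) (p b)" "A1 \<subseteq> star K1 {a, b}" "connected B1" "p z1 \<in> B1" "B1 \<subseteq> star K1 {z1}"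
    "B1 \<inter> A1 = {}" "closure B1 \<inter> (A1 - {p a, p b}) \<noteq> {}"
    using K33_leg[OF K(1,2) side(1,2) ab(3) side(3-5) j(1,4) z(2)] .
  obtain A2 B2 where 2: "arc_between A2 (p a) (p b)" "A2 \<subseteq> star K2 {a, b}" "connected B2" "p z2 \<in> B2" "B2 \<subseteq> star K2 {z2}"
    "B2 \<inter> A2 = {}" "closure B2 \<inter> (A2 - {p a, p b}) \<noteq> {}"
    using K33_leg[OF K(3,4) side(6,7) ab(3) side(8-10) j(2,5) z(4)] .
  obtain A3 B3 where 3: "arc_between A3 (p a) (p b)" "A3 \<subseteq> star K3 {a, b}" "connected B3" "p z3 \<in> B3" "B3 \<subseteq> star K3 {z3}"
    "B3 \<inter> A3 = {}" "closure B3 \<inter> (A3 - {p a, p b}) \<noteq> {}"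
    using K33_leg[OF K(5,6) side(11,12) ab(3) side(13-15) j(3,6) z(6)] .
  define Y where "Y = ((star Z {} \<union> B1) \<union> B2) \<union> B3"
  have pz: "p z1 \<in> star Z {}" "p z2 \<in> star Z {}" "p z3 \<in> star Z {}" using z by (auto simp: star_def)
  have "connected (star Z {})" using star_path_connected[OF Z] by (rule path_connected_imp_connected)
  then have conY: "connected Y"
    unfolding Y_def using 1(3,4) 2(3,4) 3(3,4) pz by (intro connected_Un) auto
  have AA: "star K L \<inter> star K' L \<subseteq> p ` L" if "K \<subseteq> V" "K' \<subseteq> V" "K \<inter> K' = {}" "K \<inter> L = {}" "K' \<inter> L = {}" for K K' L
    using star_inter[OF that(1,2,3,4,5)] by simp
  have A12: "A1 \<inter> A2 \<subseteq> {p a, p b}"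
    using AA[of K1 K2 "{a, b}"] 1(2) 2(2) K disj ab by blast
  have A13: "A1 \<inter> A3 \<subseteq> {p a, p b}"
    using AA[of K1 K3 "{a, b}"] 1(2) 3(2) K disj ab by blast
  have A23: "A2 \<inter> A3 \<subseteq> {p a, p b}"
    using AA[of K2 K3 "{a, b}"] 2(2) 3(2) K disj ab by blast
  have BA: "B \<inter> A = {}" if "B \<subseteq> star L {z}" "A \<subseteq> star M {a, b}" "L \<subseteq> V" "M \<subseteq> V" "L \<inter> M = {}" "z \<in> Z" "Z \<inter> M = {}" 
      "a \<notin> L" "b \<notin> L" for A B L M z
  proof -
    have "star L {z} \<inter> star M {a, b} \<subseteq> p ` ({z} \<inter> {a, b})"
      using that ab by (intro star_inter) auto
    moreover have "{z} \<inter> {a, b} = {}" using ab that(6) by auto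
    ultimately show ?thesis using that(1,2) by blast
  qed
  have ZA: "star Z {} \<inter> A = {}" if "A \<subseteq> star M {a, b}" "M \<subseteq> V" "Z \<inter> M = {}" for A M
    using star_inter[OF Z(1) that(2,3), of "{a, b}" "{}"] ab that(1) by blast
  have "Y \<inter> A1 = {}"
    unfolding Y_def using ZA[OF 1(2) K(1) disj(4)] 1(6) BA[OF 2(5) 1(2)] BA[OF 3(5) 1(2)] z disj K ab by blast
  moreover have "Y \<inter> A2 = {}"
    unfolding Y_def using ZA[OF 2(2) K(3) disj(5)] 2(6) BA[OF 1(5) 2(2)] BA[OF 3(5) 2(2)] z disj K ab by blast
  moreover have "Y \<inter> A3 = {}"
    unfolding Y_def using ZA[OF 3(2) K(5) disj(6)] 3(6) BA[OF 1(5) 3(2)] BA[OF 2(5) 3(2)] z disj K ab by blast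
  ultimately have Y0: "Y \<inter> (A1 \<union> A2 \<union> A3) = {}" by blast
  have cl: "closure B1 \<subseteq> closure Y" "closure B2 \<subseteq> closure Y" "closure B3 \<subseteq> closure Y"
    by (intro closure_mono; auto simp: Y_def)+
  show False
    by (rule theta_curve_touch3[OF 1(1) 2(1) 3(1) A12 A13 A23 conY Y0]) (use cl 1(7) 2(7) 3(7) in blast)+
qed

text \<open>Inside its star, Z yields a tripod ending at a, b and c. The drawing of K with half-open
  edges to a, b, c and a half-open leg to the tripod is the set Y of \<open>no_plane_K5\<close>.
  That leg may arrive anywhere on the tripod, whence the point q there.\<close>

lemma no_K5_minor:
  assumes Z: "Z \<subseteq> V" "connected_set E Z" and K: "K \<subseteq> V" "connected_set E K" and ZK: "Z \<inter> K = {}" "joined E Z K"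
    and abc: "a \<in> V" "b \<in> V" "c \<in> V" "a \<notin> Z \<union> K" "b \<notin> Z \<union> K" "c \<notin> Z \<union> K"
    and e: "{a, b} \<in> E" "{b, c} \<in> E" "{a, c} \<in> E"
    and j: "joined E {a} Z" "joined E {b} Z" "joined E {c} Z" "joined E {a} K" "joined E {b} K" "joined E {c} K"
  shows False
proof -
  have neq: "a \<noteq> b" "b \<noteq> c" "a \<noteq> c" using e edgeE by (metis doubleton_eq_iff)+
  have pneq: "p a \<noteq> p b" "p b \<noteq> p c" "p a \<noteq> p c" using neq p_inj abc by blast+
  have out: "a \<in> V - Z" "b \<in> V - Z" "c \<in> V - Z" "a \<in> V - K" "b \<in> V - K" "c \<in> V - K" using abc by auto
  obtain C where C: "arc_between C (p a) (p b)" "C \<subseteq> star Z {a, b}" "C \<inter> star Z {} \<noteq> {}"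
    using arc_through[OF Z out(1,2) neq(1) j(1,2)] .
  obtain zc where zc: "zc \<in> Z" "{c, zc} \<in> E" using j(3) unfolding joined_def by auto
  have "p c \<in> star Z {c}"
    using line_subset_star[OF zc(2,1), of "{c}"] line_vertex[OF zc(2) abc(3)] by blast
  moreover have "p c \<notin> C" using star_vertex[OF Z(1) abc(3)] out neq C(2) by blast
  moreover have "star Z {c} \<inter> C \<noteq> {}" using C(3) star_mono[of "{}" "{c}" Z] by blast
  \<comment> \<open>The leg from c meets C at the centre t of the tripod; cutting C at t gives the
    other two legs.\<close>
  ultimately obtain lc t where lc: "arc_between lc (p c) t" "lc \<subseteq> star Z {c}" "lc \<inter> C = {t}"
    using first_hit_arc[OF star_path_connected[OF Z]] arc_betweenD(1)[OF C(1)] compact_imp_closed by metis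
  have t: "t \<noteq> p a" "t \<noteq> p b" "t \<in> C"
    using lc(2,3) star_vertex[OF Z(1) abc(1), of "{c}"] star_vertex[OF Z(1) abc(2), of "{c}"] out neq by blast+
  obtain la lb where l: "arc_between la (p a) t" "arc_between lb t (p b)" "la \<union> lb = C" "la \<inter> lb = {t}"
    using arc_between_split[OF C(1) t(3,1,2)] .
  have legs: "arc_between la t (p a)" "arc_between lb t (p b)" "arc_between lc t (p c)"
    using l lc arc_between_sym by blast+
  let ?T = "la \<union> lb \<union> lc"
  have T: "?T \<subseteq> star Z {a, b, c}"
    using l(3) C(2) lc(2) star_mono[of "{a, b}" "{a, b, c}" Z] star_mono[of "{c}" "{a, b, c}" Z] by blast
  have "compact ?T" using legs arc_betweenD(1) by blast
  then have "closed ?T" by (rule compact_imp_closed)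
  obtain z k where zk: "z \<in> Z" "k \<in> K" "{k, z} \<in> E" using ZK(2) unfolding joined_def by (metis insert_commute)
  then have kV: "k \<in> V - Z" "k \<notin> {a, b, c}" "z \<notin> K" using K(1) ZK(1) abc by auto
  have "joined E {k} Z" using zk unfolding joined_def by auto
  moreover have "p k \<notin> ?T" using star_vertex[OF Z(1), of k "{a, b, c}"] kV T by blast
  moreover have "?T \<inter> star Z {} \<noteq> {}" using C(3) l(3) by blast
  \<comment> \<open>Here Z is the branch set and k, a vertex of K, is the outside vertex: the leg
    leaves K and runs through the star of Z to the tripod.\<close>
  ultimately obtain B q where B: "connected (B - {q})" "p k \<in> B - {q}" "B \<subseteq> star Z {k}" "B \<inter> ?T = {q}" "q \<in> closure (B - {q})"
    using branch_leg[OF Z kV(1) _ \<open>closed ?T\<close>] by metis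
  have q: "q \<noteq> p a" "q \<noteq> p b" "q \<noteq> p c"
    using B(3,4) star_vertex[OF Z(1), of _ "{k}"] out kV by blast+
  \<comment> \<open>An edge line from K without its end \<open>p v\<close>, so that Y avoids the
    triangle and the tripod but touches them at v.\<close>
  have foot: "\<exists>D. connected D \<and> D \<inter> star K {} \<noteq> {} \<and> p v \<in> closure D \<and> p v \<notin> D \<and> D \<subseteq> star K {v}"
    if v: "v \<in> V - K" "joined E {v} K" for v
  proof -
    obtain m where m: "m \<in> K" "{v, m} \<in> E" using v(2) unfolding joined_def by auto
    have arc: "arc_between (line {v, m}) (p m) (p v)" using line_arc[OF m(2)] arc_between_sym by blast
    note D = arc_betweenD[OF arc] arc_between_half_open[OF arc]
    have "p m \<in> (line {v, m} - {p v}) \<inter> star K {}" using D(4,6) m(1) by (auto simp: star_def)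
    then show ?thesis
      using D(5,9,10) line_subset_star[OF m(2,1), of "{v}"] by (intro exI[of _ "line {v, m} - {p v}"]) auto
  qed
  obtain Da where Da: "connected Da" "Da \<inter> star K {} \<noteq> {}" "p a \<in> closure Da" "p a \<notin> Da" "Da \<subseteq> star K {a}"
    using foot[OF out(4) j(4)] by blast
  obtain Db where Db: "connected Db" "Db \<inter> star K {} \<noteq> {}" "p b \<in> closure Db" "p b \<notin> Db" "Db \<subseteq> star K {b}"
    using foot[OF out(5) j(5)] by blast
  obtain Dc where Dc: "connected Dc" "Dc \<inter> star K {} \<noteq> {}" "p c \<in> closure Dc" "p c \<notin> Dc" "Dc \<subseteq> star K {c}"
    using foot[OF out(6) j(6)] by blast
  define Y where "Y = (((star K {} \<union> (B - {q})) \<union> Da) \<union> Db) \<union> Dc"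
  have "connected (star K {})" using star_path_connected[OF K] by (rule path_connected_imp_connected)
  moreover have "p k \<in> star K {}" using zk(2) by (auto simp: star_def)
  ultimately have conY: "connected Y"
    unfolding Y_def using B(1,2) Da(1,2) Db(1,2) Dc(1,2) by (intro connected_Un) auto
  have clY: "p a \<in> closure Y" "p b \<in> closure Y" "p c \<in> closure Y" "q \<in> closure Y"
    using Da(3) Db(3) Dc(3) B(5) closure_mono[of Da Y] closure_mono[of Db Y] closure_mono[of Dc Y] closure_mono[of "B - {q}" Y]
    unfolding Y_def by blast+
  have KZ: "star K {v} \<inter> star Z {a, b, c} \<subseteq> {p v}" if "v \<notin> Z" for v
    using star_inter[OF K(1) Z(1), of "{a, b, c}" "{v}"] ZK(1) out that by blast
  have KZ0: "star K {} \<inter> star Z {a, b, c} = {}"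
    using star_inter[OF K(1) Z(1), of "{a, b, c}" "{}"] ZK(1) out by blast
  have Kline: "star K {v} \<inter> line {x, y} \<subseteq> {p v}" "star K {} \<inter> line {x, y} = {}"
    if "{x, y} \<in> E" "x \<in> V - K" "y \<in> V - K" for v x y
    using star_line_inter[OF K(1) that(1), of "{v}"] star_line_inter[OF K(1) that(1), of "{}"] that(2,3) by blast+
  have Bline: "B \<inter> line {x, y} = {}" if "{x, y} \<in> E" "x \<in> {a, b, c}" "y \<in> {a, b, c}" for x y
  proof -
    have "star Z {k} \<inter> line {x, y} \<subseteq> p ` ({k} \<inter> {x, y})"
      using that out by (intro star_line_inter Z(1)) auto
    then show ?thesis using kV(2) that B(3) by blast
  qed
  have YT: "Y \<inter> ?T = {}"
  proof -
    have "Da \<inter> ?T = {}" using KZ[of a] T Da(4,5) out(1) by blast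
    moreover have "Db \<inter> ?T = {}" using KZ[of b] T Db(4,5) out(2) by blast
    moreover have "Dc \<inter> ?T = {}" using KZ[of c] T Dc(4,5) out(3) by blast
    moreover have "star K {} \<inter> ?T = {}" using KZ0 T by blast
    ultimately show ?thesis using B(4) unfolding Y_def by blast
  qed
  have Yl: "Y \<inter> line {x, y} = {}" if "{x, y} \<in> E" "x \<in> {a, b, c}" "y \<in> {a, b, c}" for x y
  proof -
    have xy: "x \<in> V - K" "y \<in> V - K" using that out by auto
    show ?thesis
    proof -
      have "Da \<inter> line {x, y} = {}" using Kline(1)[OF that(1) xy, of a] Da(4,5) by blast
      moreover have "Db \<inter> line {x, y} = {}" using Kline(1)[OF that(1) xy, of b] Db(4,5) by blast
      moreover have "Dc \<inter> line {x, y} = {}" using Kline(1)[OF that(1) xy, of c] Dc(4,5) by blast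
      ultimately show ?thesis using Kline(2)[OF that(1) xy] Bline[OF that] unfolding Y_def by blast
    qed
  qed
  have Y0: "Y \<inter> (la \<union> lb \<union> lc \<union> line {a, b} \<union> line {b, c} \<union> line {a, c}) = {}"
    using YT Yl[OF e(1)] Yl[OF e(2)] Yl[OF e(3)] by auto
  have Zl: "star Z Q \<inter> line {x, y} \<subseteq> p ` (Q \<inter> {x, y})" if "{x, y} \<in> E" "x \<in> {a, b, c}" "y \<in> {a, b, c}" for x y Q
    using that out by (intro star_line_inter Z(1)) auto
  have onleg: "p b \<notin> la" "p a \<notin> lb"
    using l(4) arc_betweenD(5)[OF l(2)] arc_betweenD(4)[OF l(1)] t(1,2) by auto
  have lasub: "la \<subseteq> star Z {a, b}" "lb \<subseteq> star Z {a, b}" using l(3) C(2) by auto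
  have li: "line {a, b} \<inter> line {b, c} \<subseteq> {p b}" "line {a, b} \<inter> line {a, c} \<subseteq> {p a}" "line {b, c} \<inter> line {a, c} \<subseteq> {p c}"
  proof -
    have "{a, b} \<noteq> {b, c}" "{a, b} \<noteq> {a, c}" "{b, c} \<noteq> {a, c}" using neq by (auto simp: doubleton_eq_iff)
    then have "line {a, b} \<inter> line {b, c} \<subseteq> p ` ({a, b} \<inter> {b, c})" "line {a, b} \<inter> line {a, c} \<subseteq> p ` ({a, b} \<inter> {a, c})"
       "line {b, c} \<inter> line {a, c} \<subseteq> p ` ({b, c} \<inter> {a, c})"
      by (simp_all only: line_inter e not_False_eq_True)
    then show "line {a, b} \<inter> line {b, c} \<subseteq> {p b}" "line {a, b} \<inter> line {a, c} \<subseteq> {p a}" "line {b, c} \<inter> line {a, c} \<subseteq> {p c}"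
      using neq by auto
  qed
  have sets: "{a, b} \<inter> {b, c} = {b}" "{a, b} \<inter> {a, c} = {a}" "{c} \<inter> {a, b} = {}" "{c} \<inter> {b, c} = {c}" "{c} \<inter> {a, c} = {c}"
    using neq by auto
  note Z1 = Zl[OF e(1)] and Z2 = Zl[OF e(2)] and Z3 = Zl[OF e(3)]
  show False
  proof (rule no_plane_K5[OF legs line_arc[OF e(1)] line_arc[OF e(2)] line_arc[OF e(3)] _ _ _ _ _ _ _ _ _ _ _ _ li conY Y0 clY _ q])
    show "la \<inter> lb \<subseteq> {t}" "la \<inter> lc \<subseteq> {t}" "lb \<inter> lc \<subseteq> {t}" using l(3,4) lc(3) by auto
    show "la \<inter> line {a, b} \<subseteq> {p a}" "lb \<inter> line {a, b} \<subseteq> {p b}" using Z1[of "{a, b}"] lasub onleg by auto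
    show "lc \<inter> line {a, b} = {}" using Z1[of "{c}"] lc(2) unfolding sets by auto
    show "la \<inter> line {b, c} = {}" "lb \<inter> line {b, c} \<subseteq> {p b}" using Z2[of "{a, b}"] lasub onleg unfolding sets by auto
    show "lc \<inter> line {b, c} \<subseteq> {p c}" using Z2[of "{c}"] lc(2) unfolding sets by auto
    show "la \<inter> line {a, c} \<subseteq> {p a}" "lb \<inter> line {a, c} = {}" using Z3[of "{a, b}"] lasub onleg unfolding sets by auto
    show "lc \<inter> line {a, c} \<subseteq> {p c}" using Z3[of "{c}"] lc(2) unfolding sets by auto
    show "q \<in> ?T" using B(4) by blast
  qed
qed

end

subsection \<open>The graph induced by the outer vertices\<close>

definition clique :: "'a set set \<Rightarrow> 'a set \<Rightarrow> bool" where
  "clique E Q \<longleftrightarrow> (\<forall>u\<in>Q. \<forall>v\<in>Q. u \<noteq> v \<longrightarrow> {u, v} \<in> E)"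

lemma connected_set_empty: "connected_set E {}"
  by (simp add: connected_set_def)

lemma connected_set_singleton: "connected_set E {v}"
  by (auto simp: connected_set_def)

lemma connected_set_insert:
  assumes "connected_set E U" "joined E {v} U"
  shows "connected_set E (insert v U)"
  unfolding connected_set_def
proof (intro allI impI)
  fix A assume A: "A \<subseteq> insert v U" "A \<noteq> {}" "A \<noteq> insert v U"
  obtain u where u: "u \<in> U" "{v, u} \<in> E" "{u, v} \<in> E"
    using assms(2) unfolding joined_def by (auto simp: insert_commute)
  consider "A \<inter> U = {}" | "A \<inter> U = U" | "A \<inter> U \<noteq> {}" "A \<inter> U \<noteq> U" by blast
  then show "\<exists>a\<in>A. \<exists>b\<in>insert v U - A. {a, b} \<in> E"
  proof cases
    case 1
    then have "v \<in> A" "u \<notin> A" using A u by auto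
    then show ?thesis using u by blast
  next
    case 2
    then have "u \<in> A" "v \<notin> A" using A u by auto
    then show ?thesis using u by blast
  next
    case 3
    then obtain a b where "a \<in> A \<inter> U" "b \<in> U - A \<inter> U" "{a, b} \<in> E"
      using assms(1) unfolding connected_set_def by (metis inf_le2)
    then show ?thesis by blast
  qed
qed

lemma not_connected_setE:
  assumes "\<not> connected_set E U"
  obtains A B where "A \<union> B = U" "A \<inter> B = {}" "A \<noteq> {}" "B \<noteq> {}" "\<And>a b. a \<in> A \<Longrightarrow> b \<in> B \<Longrightarrow> {a, b} \<notin> E"
proof -
  obtain A where "A \<subseteq> U" "A \<noteq> {}" "A \<noteq> U" "\<forall>a\<in>A. \<forall>b\<in>U - A. {a, b} \<notin> E"
    using assms unfolding connected_set_def by blast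
  then show ?thesis by (intro that[of A "U - A"]) auto
qed

lemma connected_component_exists:
  assumes "finite U" "x \<in> U"
  obtains K where "x \<in> K" "K \<subseteq> U" "connected_set E K" "\<And>u. u \<in> U - K \<Longrightarrow> \<not> joined E {u} K"
proof -
  let ?P = "\<lambda>K. x \<in> K \<and> K \<subseteq> U \<and> connected_set E K"
  have "?P {x}" using assms connected_set_singleton by auto
  moreover have "\<forall>K. ?P K \<longrightarrow> card K < Suc (card U)"
    using assms(1) by (auto simp: less_Suc_eq_le card_mono)
  ultimately obtain K where K: "?P K" "\<And>L. ?P L \<Longrightarrow> card L \<le> card K"
    using ex_has_greatest_nat[of ?P "{x}" card "Suc (card U)"] by blast
  show ?thesis
  proof (rule that)
    fix u assume u: "u \<in> U - K"
    show "\<not> joined E {u} K"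
    proof
      assume "joined E {u} K"
      then have "?P (insert u K)" using K(1) u connected_set_insert by auto
      moreover have "finite K" using K(1) assms(1) finite_subset by blast
      ultimately show False using K(2)[of "insert u K"] u by auto
    qed
  qed (use K in auto)
qed

section \<open>Walks, leaves and cycles of outer vertices\<close>

abbreviation walk :: "'a set set \<Rightarrow> 'a list \<Rightarrow> bool" where
  "walk E \<equiv> successively (\<lambda>u v. {u, v} \<in> E)"

lemma walk_connected_set: "walk E xs \<Longrightarrow> connected_set E (set xs)"
proof (induction xs rule: induct_list012)
  case (3 u v xs)
  then show ?case
    by (auto intro!: connected_set_insert simp: joined_def)
qed (simp_all add: connected_set_empty connected_set_singleton)

text \<open>Take the start v of a longest path that meets y at most at its far end. By maximality
  every neighbour of v lies on the path, and a neighbour beyond the second vertex would close a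
  cycle. Admitting y only at the far end keeps v different from y.\<close>

lemma acyclic_leaf:
  assumes "finite W" "W - {y} \<noteq> {}" and loopfree: "\<And>v. {v} \<notin> E"
    and acyclic: "\<And>cs. set cs \<subseteq> W \<Longrightarrow> distinct cs \<Longrightarrow> length cs \<ge> 3 \<Longrightarrow> walk E cs \<Longrightarrow> {last cs, hd cs} \<notin> E"
  obtains v where "v \<in> W - {y}" "\<And>a b. a \<in> W \<Longrightarrow> b \<in> W \<Longrightarrow> {v, a} \<in> E \<Longrightarrow> {v, b} \<in> E \<Longrightarrow> a = b"
proof -
  define P where "P xs \<longleftrightarrow> xs \<noteq> [] \<and> distinct xs \<and> set xs \<subseteq> W \<and> walk E xs \<and> hd xs \<noteq> y \<and> y \<notin> set (butlast xs)" for xs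
  obtain u where "u \<in> W" "u \<noteq> y" using assms(2) by auto
  then have "P [u]" by (auto simp: P_def)
  moreover have "\<forall>xs. P xs \<longrightarrow> length xs < Suc (card W)"
    using assms(1) by (auto simp: P_def less_Suc_eq_le intro: order_trans[OF eq_refl card_mono] dest: distinct_card[symmetric])
  ultimately obtain xs where xs: "P xs" "\<And>ys. P ys \<Longrightarrow> length ys \<le> length xs"
    using ex_has_greatest_nat[of P "[u]" length "Suc (card W)"] by blast
  obtain v ys where vys: "xs = v # ys" using xs(1) by (cases xs) (auto simp: P_def)
  have on_path: "a \<in> set ys" if a: "a \<in> W" "{v, a} \<in> E" for a
  proof (rule ccontr)
    assume "a \<notin> set ys"
    moreover have "a \<noteq> v" using a loopfree by auto
    ultimately have new: "a \<notin> set xs" by (simp add: vys)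
    show False
    proof (cases "a = y")
      case False
      have "P (a # xs)"
        using xs(1) new a False unfolding P_def vys by (auto simp: insert_commute)
      then show False using xs(2) by fastforce
    next
      \<comment> \<open>Since y may only come last, it cannot be prepended; instead the path is
        reversed and y appended.\<close>
      case True
      have "walk E (rev xs)" using xs(1) unfolding P_def by (simp add: insert_commute)
      then have "P (rev xs @ [y])"
        using xs(1) new a True unfolding P_def vys by (auto simp: successively_append_iff hd_append hd_rev butlast_append split: if_splits)
      then show False using xs(2) by fastforce
    qed
  qed
  have first: "a = hd ys" if a: "a \<in> W" "{v, a} \<in> E" for a
  proof (rule ccontr)
    assume ne: "a \<noteq> hd ys"
    obtain q r where qr: "ys = q @ a # r" using on_path[OF a] by (auto simp: in_set_conv_decomp)
    then have "q \<noteq> []" using ne by auto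
    let ?c = "v # q @ [a]"
    have "set ?c \<subseteq> W" "distinct ?c" "length ?c \<ge> 3" "walk E ?c"
      using xs(1) \<open>q \<noteq> []\<close> unfolding P_def vys qr by (auto simp: successively_append_iff successively_Cons Suc_le_eq)
    then have "{last ?c, hd ?c} \<notin> E" by (rule acyclic)
    then show False using a by (simp add: insert_commute)
  qed
  show ?thesis
  proof (rule that[of v])
    show "v \<in> W - {y}" using xs(1) by (auto simp: P_def vys)
    show "a = b" if "a \<in> W" "b \<in> W" "{v, a} \<in> E" "{v, b} \<in> E" for a b
      using first[of a] first[of b] that by simp
  qed
qed

definition outer :: "'a set set \<Rightarrow> 'a set \<Rightarrow> 'a set \<Rightarrow> 'a set" where
  "outer E Z G = {v\<in>G. joined E {v} Z}"

context plane_drawing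
begin

lemma finite_V: "finite V"
  using simple by (simp add: simple_graph_def)

lemma loopfree: "{v} \<notin> E"
  by (rule simple_graph_loopfree[OF simple])

lemma no_outer_cycle:
  assumes Z: "Z \<subseteq> V" "connected_set E Z" and G: "G \<subseteq> V" "Z \<inter> G = {}"
    and conn: "\<And>Q. Q \<subseteq> outer E Z G \<Longrightarrow> clique E Q \<Longrightarrow> card Q \<le> 2 \<Longrightarrow> connected_set E (G - Q)"
    and x: "x \<in> outer E Z G"
    and cs: "set cs \<subseteq> outer E Z G - {x}" "distinct cs" "length cs \<ge> 3" "walk E cs"
  shows "{last cs, hd cs} \<notin> E"
proof
  assume closed: "{last cs, hd cs} \<in> E"
  let ?D = "set cs"
  have D: "?D \<subseteq> G" "x \<in> G - ?D" using cs(1) x by (auto simp: outer_def)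
  have finG: "finite G" using G(1) finite_V finite_subset by blast
  then obtain K where K: "x \<in> K" "K \<subseteq> G - ?D" "connected_set E K" "\<And>u. u \<in> G - ?D - K \<Longrightarrow> \<not> joined E {u} K"
    using connected_component_exists[of "G - ?D" x] D by blast
  have jZ: "joined E {v} Z" if "v \<in> ?D" for v using that cs(1) by (auto simp: outer_def)
  have "joined E Z {x}" using x joined_sym[of E Z] by (simp add: outer_def)
  then have jZK: "joined E Z K" using K(1) by (auto simp: joined_def)
  define T where "T = {d\<in>?D. joined E {d} K}"
  have TD: "T \<subseteq> ?D" by (auto simp: T_def)
  have KV: "K \<subseteq> V" "Z \<inter> K = {}" using K(2) G by auto
  show False
  proof (cases "clique E T")
    case True
    show False
    proof (cases "card T \<le> 2")
      case le2: True
      have "connected_set E (G - T)"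
        using TD cs(1) by (intro conn True le2) auto
      \<comment> \<open>With at most two attachments some vertex of the cycle is outside T, so K
        does not exhaust \<open>G - T\<close>.\<close>
      moreover have "card ?D \<ge> 3" using cs(2,3) by (simp add: distinct_card)
      then have "\<not> ?D \<subseteq> T" using le2 card_mono[of T ?D] TD finite_subset[OF TD] by fastforce
      then have "K \<noteq> G - T" "K \<subseteq> G - T" "K \<noteq> {}" using K(1,2) D TD by blast+
      ultimately obtain a b where ab: "a \<in> K" "b \<in> G - T - K" "{a, b} \<in> E"
        unfolding connected_set_def by blast
      then have "joined E {b} K" unfolding joined_def by (auto simp: insert_commute)
      then show False using K(4)[of b] ab by (auto simp: T_def)
    next
      case False
      then obtain T' where "T' \<subseteq> T" "card T' = 3"
        by (metis Suc_leI not_le numeral_3_eq_3 numeral_2_eq_2 obtain_subset_with_card_n)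
      then obtain a b c where abc: "a \<in> T" "b \<in> T" "c \<in> T" "a \<noteq> b" "b \<noteq> c" "a \<noteq> c"
        unfolding card_3_iff by blast
      then have "{a, b} \<in> E" "{b, c} \<in> E" "{a, c} \<in> E" using True unfolding clique_def by blast+
      moreover have "a \<in> V - (Z \<union> K)" "b \<in> V - (Z \<union> K)" "c \<in> V - (Z \<union> K)"
        using abc TD D(1) G K(2) by blast+
      ultimately show False
        using no_K5_minor[OF Z KV(1) K(3) KV(2) jZK, of a b c] abc jZ TD unfolding T_def by auto
    qed
  next
    case False
    then obtain a b where ab: "a \<in> T" "b \<in> T" "a \<noteq> b" "{a, b} \<notin> E" unfolding clique_def by blast
    \<comment> \<open>Nonadjacency is symmetric, so the two vertices may be renamed in the order of
      their occurrence in \<open>cs\<close>.\<close>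
    have "\<exists>a b u p w. a \<in> T \<and> b \<in> T \<and> {a, b} \<notin> E \<and> cs = u @ a # p @ b # w"
    proof -
      obtain q r where qr: "cs = q @ a # r" using ab(1) TD by (metis split_list subsetD)
      then consider "b \<in> set q" | "b \<in> set r" using ab(2,3) TD by auto
      then show ?thesis
      proof cases
        case 1
        then obtain q1 q2 where "q = q1 @ b # q2" by (metis split_list)
        then show ?thesis using ab qr by (intro exI[of _ b] exI[of _ a] exI[of _ q1] exI[of _ q2] exI[of _ r]) (auto simp: insert_commute)
      next
        case 2
        then obtain q1 q2 where "r = q1 @ b # q2" by (metis split_list)
        then show ?thesis using ab qr by (intro exI[of _ a] exI[of _ b] exI[of _ q] exI[of _ q1] exI[of _ q2]) auto
      qed
    qed
    then obtain a b u p w where ab: "a \<in> T" "b \<in> T" "{a, b} \<notin> E" and eq: "cs = u @ a # p @ b # w" by blast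
    have neq: "a \<noteq> b" using cs(2) eq by auto
    have mid: "walk E (a # p @ b # w)" using cs(4) unfolding eq by (simp add: successively_append_iff)
    then have "p \<noteq> []" using ab(3) by auto
    then have p: "p \<noteq> []" "walk E p" "{a, hd p} \<in> E" "{last p, b} \<in> E"
      using mid by (simp_all add: successively_append_iff successively_Cons)
    \<comment> \<open>The second arc of the cycle continues from b past the end of \<open>cs\<close>
      to its beginning and up to a; were it empty, the closing edge would join a and b.\<close>
    have wu: "w @ u \<noteq> []" using closed ab(3) unfolding eq by (auto simp: insert_commute)
    have wwu: "walk E (w @ u)" "{b, hd (w @ u)} \<in> E" "{last (w @ u), a} \<in> E"
      using cs(4) closed wu unfolding eq
      by (cases u; cases w rule: rev_cases; auto simp: successively_append_iff successively_Cons hd_append split: if_splits)+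
    have sub: "set p \<subseteq> ?D" "set (w @ u) \<subseteq> ?D" unfolding eq by auto
    have d: "set p \<inter> set (w @ u) = {}" "a \<notin> set p" "b \<notin> set p" "a \<notin> set (w @ u)" "b \<notin> set (w @ u)"
      using cs(2) unfolding eq by auto
    have "joined E {a} K" "joined E {b} K" using ab by (auto simp: T_def)
    moreover have "joined E {a} (set p)" "joined E {b} (set p)" "joined E {a} (set (w @ u))" "joined E {b} (set (w @ u))"
      using p wwu wu unfolding joined_def by (metis hd_in_set last_in_set insertI1 insert_commute)+
    moreover have "joined E Z (set L)" if "L \<noteq> []" "set L \<subseteq> ?D" for L
      using jZ[of "hd L"] that joined_sym[of E Z] unfolding joined_def by (metis hd_in_set singletonD subsetD)
    then have "joined E Z (set p)" "joined E Z (set (w @ u))" using p(1) wu sub by blast+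
    moreover have "a \<in> V" "b \<in> V" "a \<notin> Z" "b \<notin> Z" "a \<notin> K" "b \<notin> K" using ab TD D G K(2) by blast+
    moreover have "set p \<subseteq> V" "set (w @ u) \<subseteq> V" "K \<inter> set p = {}" "K \<inter> set (w @ u) = {}" "Z \<inter> set p = {}" "Z \<inter> set (w @ u) = {}"
      using sub D G K(2) by blast+
    ultimately show False
      using no_K33_minor[OF Z KV(1) K(3) _ walk_connected_set[OF p(2)] _ walk_connected_set[OF wwu(1)], of a b]
        neq d jZK KV(2) by auto
  qed
qed

text \<open>Without x the outer vertices induce a forest. The other member of X, if any, is the
  vertex that the leaf has to avoid.\<close>

lemma outer_leaf:
  assumes "Z \<subseteq> V" "connected_set E Z" "G \<subseteq> V" "Z \<inter> G = {}"
    and "\<And>Q. Q \<subseteq> outer E Z G \<Longrightarrow> clique E Q \<Longrightarrow> card Q \<le> 2 \<Longrightarrow> connected_set E (G - Q)"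
    and X: "X \<subseteq> outer E Z G" "card X \<le> 2" "x \<in> X" "\<not> outer E Z G \<subseteq> X"
  obtains v where "v \<in> outer E Z G - X"
    "\<And>a b. a \<in> outer E Z G - {x} \<Longrightarrow> b \<in> outer E Z G - {x} \<Longrightarrow> {v, a} \<in> E \<Longrightarrow> {v, b} \<in> E \<Longrightarrow> a = b"
proof -
  let ?S = "outer E Z G"
  have fin: "finite ?S" using assms(3) finite_V finite_subset by (fastforce simp: outer_def)
  have "card (X - {x}) \<le> Suc 0"
    using X(2,3) finite_subset[OF X(1) fin] by simp
  then have "\<forall>a\<in>X - {x}. \<forall>b\<in>X - {x}. a = b"
    using finite_subset[OF X(1) fin] card_le_Suc0_iff_eq[of "X - {x}"] by simp
  then have "\<exists>y. X \<subseteq> {x, y}" by (cases "X - {x} = {}") blast+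
  then obtain y where y: "X \<subseteq> {x, y}" ..
  \<comment> \<open>For \<open>X = {x}\<close> the vertex to avoid defaults to x, which has already
    been removed.\<close>
  show ?thesis
  proof (rule acyclic_leaf[of "?S - {x}" "if y \<in> X then y else x" E])
    show "?S - {x} - {if y \<in> X then y else x} \<noteq> {}" using X y by (auto split: if_splits)
    fix cs assume "set cs \<subseteq> ?S - {x}" "distinct cs" "length cs \<ge> 3" "walk E cs"
    then show "{last cs, hd cs} \<notin> E"
      using X by (intro no_outer_cycle[OF assms(1-5)]) auto
  next
    fix v assume "v \<in> ?S - {x} - {if y \<in> X then y else x}"
      "\<And>a b. a \<in> ?S - {x} \<Longrightarrow> b \<in> ?S - {x} \<Longrightarrow> {v, a} \<in> E \<Longrightarrow> {v, b} \<in> E \<Longrightarrow> a = b"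
    then show thesis using y by (intro that[of v]) (auto split: if_splits)
  qed (use fin loopfree in auto)
qed

end

subsection \<open>Extending colourings\<close>

text \<open>Lists are in reverse order: the head is the last vertex to be coloured.\<close>

fun back_bounded :: "('a \<Rightarrow> 'a \<Rightarrow> bool) \<Rightarrow> ('a \<Rightarrow> nat) \<Rightarrow> 'a list \<Rightarrow> bool" where
  "back_bounded R g [] \<longleftrightarrow> True"
| "back_bounded R g (v # xs) \<longleftrightarrow> back_bounded R g xs \<and> card {u\<in>set xs. R u v} < g v"

abbreviation degenerate_order :: "('a \<times> nat) set set \<Rightarrow> (nat \<Rightarrow> 'a \<Rightarrow> nat) \<Rightarrow> ('a \<Rightarrow> nat) \<Rightarrow> 'a list \<Rightarrow> bool" where
  "degenerate_order H F c \<equiv> back_bounded (\<lambda>u v. {(u, c u), (v, c v)} \<in> H) (\<lambda>v. F (c v) v)"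

text \<open>The subtraction truncates: an overblocked colour gets weight 0 and is thereby
  excluded.\<close>

definition reduced :: "('a \<times> nat) set set \<Rightarrow> (nat \<Rightarrow> 'a \<Rightarrow> nat) \<Rightarrow> ('a \<Rightarrow> nat) \<Rightarrow> 'a set \<Rightarrow> nat \<Rightarrow> 'a \<Rightarrow> nat" where
  "reduced H F c W i v = F i v - card {u\<in>W. {(u, c u), (v, i)} \<in> H}"

definition F_colouring where
  "F_colouring H s F W c xs \<longleftrightarrow> distinct xs \<and> set xs = W \<and> (\<forall>v\<in>W. c v \<in> {1..s}) \<and> degenerate_order H F c xs"

text \<open>Back edges from a vertex of \<open>ys\<close> end either in \<open>ys\<close>, where
  \<open>F'\<close> bounds them, or in \<open>xs\<close>, where \<open>reduced\<close> has already
  subtracted them from \<open>F\<close>.\<close>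

lemma degenerate_order_append:
  assumes "degenerate_order H F c xs" "degenerate_order H F' c' ys" "distinct (ys @ xs)"
    and "\<And>v. v \<in> set xs \<Longrightarrow> d v = c v" "\<And>v. v \<in> set ys \<Longrightarrow> d v = c' v"
    and "\<And>v. v \<in> set ys \<Longrightarrow> F' (c' v) v \<le> reduced H F c (set xs) (c' v) v"
  shows "degenerate_order H F d (ys @ xs)"
  using assms(2,3,5,6)
proof (induction ys)
  case Nil
  have "degenerate_order H F d xs" using assms(1,4)
  proof (induction xs)
    case (Cons v xs)
    then have "{u\<in>set xs. {(u, d u), (v, d v)} \<in> H} = {u\<in>set xs. {(u, c u), (v, c v)} \<in> H}" by auto
    with Cons show ?case by auto
  qed simp
  then show ?case by simp
next
  case (Cons v ys)
  have "{u\<in>set (ys @ xs). {(u, d u), (v, d v)} \<in> H}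
      = {u\<in>set ys. {(u, c' u), (v, c' v)} \<in> H} \<union> {u\<in>set xs. {(u, c u), (v, c' v)} \<in> H}"
    using assms(4) Cons.prems(3) by auto
  then have "card {u\<in>set (ys @ xs). {(u, d u), (v, d v)} \<in> H}
      \<le> card {u\<in>set ys. {(u, c' u), (v, c' v)} \<in> H} + card {u\<in>set xs. {(u, c u), (v, c' v)} \<in> H}"
    by (simp only: card_Un_le)
  also have "\<dots> < F (c' v) v"
    using Cons.prems(1) Cons.prems(4)[of v] unfolding reduced_def by auto
  finally show ?case using Cons by auto
qed

text \<open>Weights are compared only at the colour that each vertex finally receives. This permits
  the colour of an early vertex to be picked late: only its clashes with the colours in use have to
  be paid for.\<close>

lemma F_colouring_union:
  assumes "F_colouring H s F W1 c xs" "F_colouring H s F' W2 c' ys" "W1 \<inter> W2 = {}"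
    and "\<And>v. v \<in> W2 \<Longrightarrow> F' (c' v) v \<le> reduced H F c W1 (c' v) v"
  shows "\<exists>d zs. F_colouring H s F (W1 \<union> W2) d zs"
proof (intro exI)
  let ?d = "\<lambda>v. if v \<in> W1 then c v else c' v"
  have "degenerate_order H F ?d (ys @ xs)"
    using assms unfolding F_colouring_def by (intro degenerate_order_append[where c = c and c' = c' and F = F and F' = F']) auto
  then show "F_colouring H s F (W1 \<union> W2) ?d (ys @ xs)"
    using assms unfolding F_colouring_def by auto
qed

lemma F_colouring_singleton:
  "k \<in> {1..s} \<Longrightarrow> 0 < F k v \<Longrightarrow> F_colouring H s F {v} (\<lambda>_. k) [v]"
  by (simp add: F_colouring_def)

text \<open>The degeneracy bound is strict, so weight 0 forbids a colour. This is how weights encode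
  lists.\<close>

lemma F_colouring_pos:
  assumes "F_colouring H s F W c xs" "v \<in> W" shows "0 < F (c v) v"
proof -
  have "degenerate_order H F c xs \<Longrightarrow> v \<in> set xs \<Longrightarrow> 0 < F (c v) v" by (induction xs) auto
  then show ?thesis using assms by (auto simp: F_colouring_def)
qed

text \<open>The matching condition in counting form: each u blocks at most one colour i, so the sets
  counted are disjoint. A is either a set of coloured vertices or a set of colours reserved at one
  vertex.\<close>

lemma sum_card_le:
  fixes C :: "nat set"
  assumes "finite A" "finite C" "\<And>u i j. u \<in> A \<Longrightarrow> i \<in> C \<Longrightarrow> j \<in> C \<Longrightarrow> P u i \<Longrightarrow> P u j \<Longrightarrow> i = j"
  shows "(\<Sum>i\<in>C. card {u\<in>A. P u i}) \<le> card {u\<in>A. \<exists>i\<in>C. P u i}"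
proof -
  have "(\<Sum>i\<in>C. card {u\<in>A. P u i}) = card (\<Union>i\<in>C. {u\<in>A. P u i})"
    using assms by (intro card_UN_disjoint[symmetric]) auto
  also have "(\<Union>i\<in>C. {u\<in>A. P u i}) = {u\<in>A. \<exists>i\<in>C. P u i}" by auto
  finally show ?thesis by simp
qed

lemma sum_posE:
  fixes g :: "nat \<Rightarrow> nat"
  assumes "sum g C \<noteq> 0" obtains k where "k \<in> C" "0 < g k"
  using assms by (metis gr0I sum.neutral)

lemma sum_ge_2_cases:
  fixes g :: "nat \<Rightarrow> nat"
  assumes "finite C" "(\<Sum>i\<in>C. g i) \<ge> 2"
  obtains k where "k \<in> C" "g k \<ge> 2" | k l where "k \<in> C" "l \<in> C" "k \<noteq> l" "g k \<ge> 1" "g l \<ge> 1"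
proof -
  have "sum g C \<noteq> 0" using assms(2) by simp
  then obtain k where k: "k \<in> C" "0 < g k" by (rule sum_posE)
  show ?thesis
  proof (cases "g k \<ge> 2")
    case False
    then have "g k = 1" using k(2) by simp
    then have "sum g (C - {k}) \<noteq> 0" using assms(2) sum.remove[OF assms(1) k(1), of g] by linarith
    then obtain l where "l \<in> C - {k}" "0 < g l" by (rule sum_posE)
    then show ?thesis using that(2)[of k l] k by auto
  qed (use that(1) k in blast)
qed

section \<open>Weights in a cover and the induction\<close>

locale plane_cover = plane_drawing V E p \<gamma>
  for V :: "'a set" and E p \<gamma> +
  fixes s :: nat and H :: "('a \<times> nat) set set"
  assumes cover: "is_cover V E (\<lambda>v. {1..s}) H"
begin

lemma cover_edge:
  assumes "u \<in> V" "v \<in> V" "u \<noteq> v" "{(u, i), (v, j)} \<in> H" shows "{u, v} \<in> E"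
proof -
  have "\<forall>u\<in>V. \<forall>v\<in>V. \<forall>c d. u \<noteq> v \<longrightarrow> {(u, c), (v, d)} \<in> H \<longrightarrow> {u, v} \<in> E"
    using cover unfolding is_cover_def by (elim conjE)
  then show ?thesis using assms by metis
qed

lemma cover_unique:
  assumes "u \<in> V" "v \<in> V" "u \<noteq> v" "i \<in> {1..s}" "j \<in> {1..s}" "j' \<in> {1..s}" "{(u, i), (v, j)} \<in> H" "{(u, i), (v, j')} \<in> H"
  shows "j = j'"
proof -
  have "\<forall>u\<in>V. \<forall>v\<in>V. {u, v} \<in> E \<longrightarrow> (\<forall>c\<in>{1..s}. \<forall>d1\<in>{1..s}. \<forall>d2\<in>{1..s}.
           {(u, c), (v, d1)} \<in> H \<longrightarrow> {(u, c), (v, d2)} \<in> H \<longrightarrow> d1 = d2)"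
    using cover unfolding is_cover_def by (elim conjE)
  then show ?thesis using cover_edge[OF assms(1-3,7)] assms by metis
qed

lemma finite_sub: "W \<subseteq> V \<Longrightarrow> finite W"
  using finite_V finite_subset by blast

text \<open>By the matching condition a coloured neighbour takes at most one unit from v, over all
  colours together.\<close>

lemma sum_reduced:
  assumes W: "W \<subseteq> V" "v \<in> V - W" "\<And>u. u \<in> W \<Longrightarrow> c u \<in> {1..s}"
  shows "(\<Sum>i=1..s. F i v) \<le> (\<Sum>i=1..s. reduced H F c W i v) + card {u\<in>W. {u, v} \<in> E}"
proof -
  have "(\<Sum>i=1..s. F i v) \<le> (\<Sum>i=1..s. reduced H F c W i v + card {u\<in>W. {(u, c u), (v, i)} \<in> H})"
    by (intro sum_mono) (simp add: reduced_def)
  also have "\<dots> = (\<Sum>i=1..s. reduced H F c W i v) + (\<Sum>i=1..s. card {u\<in>W. {(u, c u), (v, i)} \<in> H})"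
    by (rule sum.distrib)
  also have "(\<Sum>i=1..s. card {u\<in>W. {(u, c u), (v, i)} \<in> H}) \<le> card {u\<in>W. \<exists>i\<in>{1..s}. {(u, c u), (v, i)} \<in> H}"
    using W cover_unique[of _ v] finite_sub[OF W(1)] by (intro sum_card_le) blast+
  also have "\<dots> \<le> card {u\<in>W. {u, v} \<in> E}"
  proof (rule card_mono)
    show "{u\<in>W. \<exists>i\<in>{1..s}. {(u, c u), (v, i)} \<in> H} \<subseteq> {u\<in>W. {u, v} \<in> E}"
    proof
      fix u assume "u \<in> {u\<in>W. \<exists>i\<in>{1..s}. {(u, c u), (v, i)} \<in> H}"
      then show "u \<in> {u\<in>W. {u, v} \<in> E}" using W cover_edge[of u v "c u"] by auto
    qed
  qed (use finite_sub[OF W(1)] in simp)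
  finally show ?thesis by simp
qed

lemma colour_first:
  assumes "v \<in> V" "k \<in> {1..s}" "0 < F k v" "v \<notin> W" "\<exists>c xs. F_colouring H s (reduced H F (\<lambda>_. k) {v}) W c xs"
  shows "\<exists>c xs. F_colouring H s F (insert v W) c xs"
proof -
  obtain c xs where "F_colouring H s (reduced H F (\<lambda>_. k) {v}) W c xs" using assms(5) by blast
  then show ?thesis
    using F_colouring_union[OF F_colouring_singleton[of k s F v H, OF assms(2,3)]] assms(4) by simp
qed

text \<open>The colours of X do not occur: F holds the weights left on \<open>G - X\<close> after X
  has been coloured. Each neighbour in X has cost at most one unit, which is credited back, so 3 and
  5 refer to the weights before X was coloured.\<close>

theorem extend_colouring:
  assumes "Z \<subseteq> V" "connected_set E Z" "G \<subseteq> V" "Z \<inter> G = {}"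
    and "X \<subseteq> outer E Z G" "card X \<le> 2" "clique E X"
    and "\<And>v i. v \<in> G \<Longrightarrow> i \<in> {1..s} \<Longrightarrow> F i v \<le> 2"
    and "\<And>v. v \<in> G - X \<Longrightarrow> (if v \<in> outer E Z G then 3 else 5) \<le> (\<Sum>i=1..s. F i v) + card {x\<in>X. {x, v} \<in> E}"
  shows "\<exists>c xs. F_colouring H s F (G - X) c xs"
  using assms
\<comment> \<open>Merging a vertex into Z shrinks G, while putting a first vertex into X keeps G and
  shrinks \<open>G - X\<close>; the sum of both sizes drops in every case.\<close>
proof (induction "card G + card (G - X)" arbitrary: Z G X F rule: less_induct)
  case less
  note Z = less.prems(1,2) and G = less.prems(3,4) and X = less.prems(5,6,7) and F2 = less.prems(8) and Fsum = less.prems(9)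
  let ?S = "outer E Z G"
  have finG: "finite G" using finite_sub G by blast
  have XG: "X \<subseteq> G" "?S \<subseteq> G" using X(1) by (auto simp: outer_def)
  have finX: "finite X" using finite_sub XG G by blast
  have red2: "reduced H F c W i v \<le> 2" if "v \<in> G" "i \<in> {1..s}" for c W i v
    using F2[OF that] by (simp add: reduced_def)
  consider (finished) "G - X = {}"
    | (split) Q where "Q \<subseteq> ?S" "clique E Q" "card Q \<le> 2" "\<not> connected_set E (G - Q)"
    | (isolated) "G - X \<noteq> {}" "?S = {}"
    | (start) "G - X \<noteq> {}" "?S \<noteq> {}" "X = {}"
    | (absorb) "G - X \<noteq> {}" "X \<noteq> {}" "?S \<subseteq> X"
    | (remove) "G - X \<noteq> {}" "X \<noteq> {}" "\<not> ?S \<subseteq> X"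
        "\<And>Q. Q \<subseteq> ?S \<Longrightarrow> clique E Q \<Longrightarrow> card Q \<le> 2 \<Longrightarrow> connected_set E (G - Q)"
    by blast
  then show ?case
  proof cases
    case finished
    then show ?thesis by (intro exI[of _ undefined] exI[of _ "[]"]) (auto simp: F_colouring_def)
  next
    case split
    obtain A' B' where AB': "A' \<union> B' = G - Q" "A' \<inter> B' = {}" "A' \<noteq> {}" "B' \<noteq> {}"
        "\<And>a b. a \<in> A' \<Longrightarrow> b \<in> B' \<Longrightarrow> {a, b} \<notin> E"
      using not_connected_setE[OF split(4)] by metis
    \<comment> \<open>X is a clique and no edge joins the two sides, so one side misses X; it
      becomes B and is coloured second. Q may be empty, when G itself is disconnected.\<close>
    have "X \<inter> A' = {} \<or> X \<inter> B' = {}"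
    proof (rule ccontr)
      assume "\<not> ?thesis"
      then obtain a b where ab: "a \<in> X" "a \<in> A'" "b \<in> X" "b \<in> B'" by blast
      then have "a \<noteq> b" using AB'(2) by blast
      then show False using X(3) ab AB'(5)[OF ab(2,4)] by (simp add: clique_def)
    qed
    then obtain A B where AB: "A \<union> B = G - Q" "A \<inter> B = {}" "A \<noteq> {}" "B \<noteq> {}" "\<And>a b. a \<in> A \<Longrightarrow> b \<in> B \<Longrightarrow> {a, b} \<notin> E"
      and XB: "X \<inter> B = {}"
    proof
      assume "X \<inter> A' = {}"
      moreover have "{a, b} \<notin> E" if "a \<in> B'" "b \<in> A'" for a b
        using AB'(5)[OF that(2,1)] by (simp add: insert_commute)
      ultimately show thesis using AB'(1-4) by (intro that[of B' A']) auto
    next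
      assume "X \<inter> B' = {}"
      then show thesis using AB' by (intro that[of A' B']) auto
    qed
    have QG: "Q \<subseteq> G" using split(1) XG by blast
    have finAB: "finite A" "finite B" "finite Q" using AB(1) finG QG finite_subset by (metis finite_Diff finite_Un)+
    have outerA: "outer E Z (A \<union> Q) = ?S \<inter> (A \<union> Q)" and outerB: "outer E Z (B \<union> Q) = ?S \<inter> (B \<union> Q)"
      using AB(1) QG by (auto simp: outer_def)
    have "\<exists>c xs. F_colouring H s F ((A \<union> Q) - X) c xs"
    proof (rule less.hyps[OF _ Z])
      have "A \<union> Q \<subset> G" using AB QG by blast
      then have "card (A \<union> Q) < card G" using psubset_card_mono[OF finG] by blast
      moreover have "card (A \<union> Q - X) \<le> card (G - X)" using finG \<open>A \<union> Q \<subset> G\<close> by (intro card_mono) auto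
      ultimately show "card (A \<union> Q) + card (A \<union> Q - X) < card G + card (G - X)" by simp
      show "A \<union> Q \<subseteq> V" "Z \<inter> (A \<union> Q) = {}" using G \<open>A \<union> Q \<subset> G\<close> by blast+
      show "X \<subseteq> outer E Z (A \<union> Q)" using X(1) XG XB AB(1) unfolding outerA by blast
      show "card X \<le> 2" "clique E X" by fact+
      show "F i v \<le> 2" if "v \<in> A \<union> Q" "i \<in> {1..s}" for v i using F2 that \<open>A \<union> Q \<subset> G\<close> by blast
      show "(if v \<in> outer E Z (A \<union> Q) then 3 else 5) \<le> (\<Sum>i=1..s. F i v) + card {x\<in>X. {x, v} \<in> E}"
        if "v \<in> A \<union> Q - X" for v
        using Fsum[of v] that \<open>A \<union> Q \<subset> G\<close> unfolding outerA by auto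
    qed
    then obtain c xs where c: "F_colouring H s F ((A \<union> Q) - X) c xs" by blast
    \<comment> \<open>On \<open>B \<union> Q\<close> the clique Q takes the role of X. Its members
      in X are already credited in the old bound, and the others are paid for by
      \<open>sum_reduced\<close>; together they are the neighbours in Q.\<close>
    define F' where "F' = reduced H F c (A \<union> Q - X)"
    have BG: "B \<union> Q \<subset> G" using AB QG by blast
    have "\<exists>c xs. F_colouring H s F' ((B \<union> Q) - Q) c xs"
    proof (rule less.hyps[OF _ Z])
      have "card (B \<union> Q) < card G" using psubset_card_mono[OF finG] BG by blast
      moreover have "card (B \<union> Q - Q) \<le> card (G - X)" using finG BG XB by (intro card_mono) auto
      ultimately show "card (B \<union> Q) + card (B \<union> Q - Q) < card G + card (G - X)" by simp
      show "B \<union> Q \<subseteq> V" "Z \<inter> (B \<union> Q) = {}" using G BG by blast+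
      show "Q \<subseteq> outer E Z (B \<union> Q)" using split(1) unfolding outerB by blast
      show "card Q \<le> 2" "clique E Q" by fact+
      show "F' i v \<le> 2" if "v \<in> B \<union> Q" "i \<in> {1..s}" for v i
        using red2 that BG unfolding F'_def by blast
      show "(if v \<in> outer E Z (B \<union> Q) then 3 else 5) \<le> (\<Sum>i=1..s. F' i v) + card {x\<in>Q. {x, v} \<in> E}"
        if "v \<in> B \<union> Q - Q" for v
      proof -
        have v: "v \<in> B" "v \<in> G - X" "v \<in> V - (A \<union> Q - X)" using that BG XB AB(1,2) G(1) by blast+
        have "(if v \<in> outer E Z (B \<union> Q) then 3 else 5) \<le> (\<Sum>i=1..s. F i v) + card {x\<in>X. {x, v} \<in> E}"
          using Fsum[OF v(2)] v(1) unfolding outerB by auto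
        also have "(\<Sum>i=1..s. F i v) \<le> (\<Sum>i=1..s. F' i v) + card {u\<in>A \<union> Q - X. {u, v} \<in> E}"
          unfolding F'_def using c AB(1) QG G(1) v(3) by (intro sum_reduced) (auto simp: F_colouring_def)
        also have "{u\<in>A \<union> Q - X. {u, v} \<in> E} = {u\<in>Q - X. {u, v} \<in> E}" using AB(5) v(1) by blast
        also have "{x\<in>X. {x, v} \<in> E} = {x\<in>X \<inter> Q. {x, v} \<in> E}" using XG(1) XB AB(1,5) v(1) by blast
        finally have "(if v \<in> outer E Z (B \<union> Q) then 3 else 5)
            \<le> (\<Sum>i=1..s. F' i v) + (card {u\<in>Q - X. {u, v} \<in> E} + card {x\<in>X \<inter> Q. {x, v} \<in> E})" by simp
        also have "card {u\<in>Q - X. {u, v} \<in> E} + card {x\<in>X \<inter> Q. {x, v} \<in> E}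
            = card ({u\<in>Q - X. {u, v} \<in> E} \<union> {x\<in>X \<inter> Q. {x, v} \<in> E})"
          using finAB by (intro card_Un_disjoint[symmetric]) auto
        also have "{u\<in>Q - X. {u, v} \<in> E} \<union> {x\<in>X \<inter> Q. {x, v} \<in> E} = {x\<in>Q. {x, v} \<in> E}" by blast
        finally show ?thesis .
      qed
    qed
    moreover have "B \<union> Q - Q = B" using AB(1) by blast
    ultimately obtain c' ys where "F_colouring H s F' B c' ys" by auto
    then have "\<exists>d zs. F_colouring H s F ((A \<union> Q - X) \<union> B) d zs"
      using AB(1,2) unfolding F'_def by (intro F_colouring_union[OF c]) auto
    moreover have "(A \<union> Q - X) \<union> B = G - X" using AB(1) QG XB by blast
    ultimately show ?thesis by simp
  next
    case isolated
    then have "X = {}" using X(1) by simp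
    then obtain v where v: "v \<in> G" using isolated by blast
    then have "(\<Sum>i=1..s. F i v) \<noteq> 0" using Fsum[of v] isolated \<open>X = {}\<close> by auto
    then obtain k where k: "k \<in> {1..s}" "0 < F k v" by (rule sum_posE)
    \<comment> \<open>No vertex of G has a neighbour in Z, so Z is dropped and started afresh at v;
      neighbours of v keep at least 4 where 3 is required. From the initial \<open>Z = {}\<close>,
      this is where Z becomes nonempty.\<close>
    have "\<exists>c xs. F_colouring H s (reduced H F (\<lambda>_. k) {v}) ((G - {v}) - {}) c xs"
    proof (rule less.hyps[where Z = "{v}"])
      have "card (G - {v}) < card G" using finG v by (intro card_Diff1_less) auto
      then show "card (G - {v}) + card (G - {v} - {}) < card G + card (G - X)" using \<open>X = {}\<close> by simp
      show "(if u \<in> outer E {v} (G - {v}) then 3 else 5)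
          \<le> (\<Sum>i=1..s. reduced H F (\<lambda>_. k) {v} i u) + card {x\<in>{}. {x, u} \<in> E}" if "u \<in> G - {v} - {}" for u
      proof -
        have "5 \<le> (\<Sum>i=1..s. reduced H F (\<lambda>_. k) {v} i u) + card {w\<in>{v}. {w, u} \<in> E}"
          using Fsum[of u] sum_reduced[of "{v}" u "\<lambda>_. k" F] that v k G(1) isolated \<open>X = {}\<close> by fastforce
        moreover have "card {w\<in>{v}. {w, u} \<in> E} = (if u \<in> outer E {v} (G - {v}) then 1 else 0)"
          using that by (auto simp: outer_def joined_def insert_commute card_eq_0_iff card_1_singleton_iff)
        ultimately show ?thesis by (auto split: if_splits)
      qed
    qed (use v G red2 in \<open>auto simp: connected_set_singleton clique_def\<close>)
    then have "\<exists>c xs. F_colouring H s F (insert v (G - {v})) c xs"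
      using k v G(1) by (intro colour_first[of v k]) auto
    then show ?thesis using v \<open>X = {}\<close> by (simp add: insert_absorb)
  next
    case start
    then obtain v where v: "v \<in> ?S" by blast
    then have vG: "v \<in> G" using XG by blast
    then have "(\<Sum>i=1..s. F i v) \<noteq> 0" using Fsum[of v] v start by auto
    then obtain k where k: "k \<in> {1..s}" "0 < F k v" by (rule sum_posE)
    have "\<exists>c xs. F_colouring H s (reduced H F (\<lambda>_. k) {v}) (G - {v}) c xs"
    proof (rule less.hyps[OF _ Z G])
      have "card (G - {v}) < card G" using finG vG by (intro card_Diff1_less) auto
      then show "card G + card (G - {v}) < card G + card (G - X)" using start by simp
      show "(if u \<in> ?S then 3 else 5)
          \<le> (\<Sum>i=1..s. reduced H F (\<lambda>_. k) {v} i u) + card {x\<in>{v}. {x, u} \<in> E}" if "u \<in> G - {v}" for u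
        using Fsum[of u] sum_reduced[of "{v}" u "\<lambda>_. k" F] that vG k G(1) start by fastforce
    qed (use v red2 in \<open>auto simp: clique_def\<close>)
    then have "\<exists>c xs. F_colouring H s F (insert v (G - {v})) c xs"
      using k vG G(1) by (intro colour_first[of v k]) auto
    then show ?thesis using vG start by (simp add: insert_absorb)
  next
    case absorb
    then obtain x where x: "x \<in> X" by blast
    then have xG: "x \<in> G" and jx: "joined E {x} Z" using X(1) by (auto simp: outer_def)
    \<comment> \<open>All uncoloured vertices are inner. Moving x into Z cancels one unit of credit
      at its neighbours, which become outer: at least 4 remains where 3 is required.\<close>
    have "\<exists>c xs. F_colouring H s F ((G - {x}) - (X - {x})) c xs"
    proof (rule less.hyps[where Z = "insert x Z"])
      have "card (G - {x}) < card G" using finG xG by (intro card_Diff1_less) auto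
      moreover have "(G - {x}) - (X - {x}) = G - X" using x by blast
      ultimately show "card (G - {x}) + card ((G - {x}) - (X - {x})) < card G + card (G - X)" by simp
      show "connected_set E (insert x Z)" using Z(2) jx by (rule connected_set_insert)
      show "X - {x} \<subseteq> outer E (insert x Z) (G - {x})" using X(1) by (auto simp: outer_def joined_def)
      show "card (X - {x}) \<le> 2" using X(2) x finX by simp
      show "clique E (X - {x})" using X(3) by (auto simp: clique_def)
      show "(if u \<in> outer E (insert x Z) (G - {x}) then 3 else 5)
          \<le> (\<Sum>i=1..s. F i u) + card {x'\<in>X - {x}. {x', u} \<in> E}" if "u \<in> G - {x} - (X - {x})" for u
      proof -
        have u: "u \<in> G - X" "u \<notin> ?S" using that absorb x by auto
        have "5 \<le> (\<Sum>i=1..s. F i u) + card {x'\<in>X. {x', u} \<in> E}" using Fsum[OF u(1)] u(2) by simp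
        also have "{x'\<in>X. {x', u} \<in> E} = {x'\<in>X - {x}. {x', u} \<in> E} \<union> {w\<in>{x}. {w, u} \<in> E}" using x by blast
        also have "card \<dots> \<le> card {x'\<in>X - {x}. {x', u} \<in> E} + card {w\<in>{x}. {w, u} \<in> E}" by (rule card_Un_le)
        also have "card {w\<in>{x}. {w, u} \<in> E} = (if u \<in> outer E (insert x Z) (G - {x}) then 1 else 0)"
          using that u by (auto simp: outer_def joined_def insert_commute card_eq_0_iff card_1_singleton_iff)
        finally show ?thesis by (auto split: if_splits)
      qed
    qed (use xG G Z F2 in auto)
    moreover have "(G - {x}) - (X - {x}) = G - X" using x by blast
    ultimately show ?thesis by simp
  next
    case remove
    then obtain x where x: "x \<in> X" by blast
    obtain v where v: "v \<in> ?S - X"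
      and leaf: "\<And>a b. a \<in> ?S - {x} \<Longrightarrow> b \<in> ?S - {x} \<Longrightarrow> {v, a} \<in> E \<Longrightarrow> {v, b} \<in> E \<Longrightarrow> a = b"
      using outer_leaf[OF Z G remove(4) X(1,2) x remove(3)] by metis
    have vG: "v \<in> G" "v \<in> V" "joined E {v} Z" using v G(1) by (auto simp: outer_def)
    define W where "W = G - {v} - X"
    have WV: "W \<subseteq> V" "v \<notin> W" "W \<subseteq> G - X" using G(1) by (auto simp: W_def)
    have GX: "G - X = insert v W" using v vG by (auto simp: W_def)
    \<comment> \<open>The price at which v may be merged into Z: nothing at vertices already outer,
      and at most the difference between 5 and 3 at inner neighbours of v.\<close>
    have recurse: "\<exists>c xs. F_colouring H s F' W c xs"
      if le: "\<And>i u. F' i u \<le> F i u" and outer: "\<And>i u. u \<in> ?S \<Longrightarrow> F' i u = F i u"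
        and nonadj: "\<And>i u. u \<in> W \<Longrightarrow> {v, u} \<notin> E \<Longrightarrow> F' i u = F i u"
        and loss: "\<And>u. u \<in> W \<Longrightarrow> (\<Sum>i=1..s. F i u) \<le> (\<Sum>i=1..s. F' i u) + 2" for F'
      unfolding W_def
    proof (rule less.hyps[where Z = "insert v Z"])
      have "card (G - {v}) < card G" using finG vG by (intro card_Diff1_less) auto
      moreover have "card (G - {v} - X) \<le> card (G - X)" using finG by (intro card_mono) auto
      ultimately show "card (G - {v}) + card (G - {v} - X) < card G + card (G - X)" by simp
      show "connected_set E (insert v Z)" using Z(2) vG(3) by (rule connected_set_insert)
      show "X \<subseteq> outer E (insert v Z) (G - {v})" using X(1) v by (auto simp: outer_def joined_def)
      show "card X \<le> 2" "clique E X" by fact+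
      show "F' i u \<le> 2" if "u \<in> G - {v}" "i \<in> {1..s}" for u i using le[of i u] F2[of u i] that by auto
      show "(if u \<in> outer E (insert v Z) (G - {v}) then 3 else 5) \<le> (\<Sum>i=1..s. F' i u) + card {x\<in>X. {x, u} \<in> E}"
        if u: "u \<in> G - {v} - X" for u
      proof -
        have uW: "u \<in> W" "u \<in> G - X" using u by (auto simp: W_def)
        have "u \<in> outer E (insert v Z) (G - {v}) \<longleftrightarrow> u \<in> ?S \<or> {v, u} \<in> E"
          using u by (auto simp: outer_def joined_def insert_commute)
        then show ?thesis
          using Fsum[OF uW(2)] outer[of u] nonadj[OF uW(1)] loss[OF uW(1)]
          by (cases "u \<in> ?S"; cases "{v, u} \<in> E") auto
      qed
    qed (use vG G Z in auto)
    \<comment> \<open>The colour of v is picked from I after W has been coloured, yet v comes first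
      in the order. Inner neighbours give up one unit for each clashing colour in I; outer vertices
      give up none, so the colour picked must not clash with them.\<close>
    have reserve: ?thesis
      if I: "I \<subseteq> {1..s}" "card I \<le> 2" "\<And>k. k \<in> I \<Longrightarrow> 0 < F k v"
        and free: "\<And>c. (\<And>u. u \<in> W \<Longrightarrow> c u \<in> {1..s}) \<Longrightarrow>
          \<exists>k\<in>I. \<forall>u\<in>W \<inter> ?S. {(v, k), (u, c u)} \<notin> H" for I
    proof -
      have finI: "finite I" using I(1) finite_subset by blast
      define F' where "F' i u = (if u \<in> ?S then F i u else F i u - card {k\<in>I. {(v, k), (u, i)} \<in> H})" for i u
      have "\<exists>c xs. F_colouring H s F' W c xs"
      proof (rule recurse)
        show "F' i u \<le> F i u" "u \<in> ?S \<Longrightarrow> F' i u = F i u" for i u by (auto simp: F'_def)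
        show "F' i u = F i u" if "u \<in> W" "{v, u} \<notin> E" for i u
        proof -
          have "{k\<in>I. {(v, k), (u, i)} \<in> H} = {}" using cover_edge[of v u] that vG WV by blast
          then show ?thesis by (simp only: F'_def card.empty diff_zero if_cancel)
        qed
        show "(\<Sum>i=1..s. F i u) \<le> (\<Sum>i=1..s. F' i u) + 2" if "u \<in> W" for u
        proof -
          have "(\<Sum>i=1..s. F i u) \<le> (\<Sum>i=1..s. F' i u + card {k\<in>I. {(v, k), (u, i)} \<in> H})"
            by (intro sum_mono) (auto simp: F'_def)
          also have "\<dots> = (\<Sum>i=1..s. F' i u) + (\<Sum>i=1..s. card {k\<in>I. {(v, k), (u, i)} \<in> H})"
            by (rule sum.distrib)
          also have "(\<Sum>i=1..s. card {k\<in>I. {(v, k), (u, i)} \<in> H}) \<le> card {k\<in>I. \<exists>i\<in>{1..s}. {(v, k), (u, i)} \<in> H}"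
            using finI cover_unique[of v u] that vG WV I(1) by (intro sum_card_le) blast+
          also have "\<dots> \<le> card I" using finI by (intro card_mono) auto
          finally show ?thesis using I(2) by simp
        qed
      qed
      then obtain c xs where c: "F_colouring H s F' W c xs" by blast
      then obtain k where k: "k \<in> I" "\<And>u. u \<in> W \<inter> ?S \<Longrightarrow> {(v, k), (u, c u)} \<notin> H"
        using free[of c] by (auto simp: F_colouring_def)
      have "F' (c u) u \<le> reduced H F (\<lambda>_. k) {v} (c u) u" if "u \<in> W" for u
      proof (cases "u \<in> ?S")
        case True
        then have "{w\<in>{v}. {(w, k), (u, c u)} \<in> H} = {}" using k(2) that by blast
        then show ?thesis using True by (simp only: reduced_def F'_def card.empty diff_zero if_True)
      next
        case False
        have "card {w\<in>{v}. {(w, k), (u, c u)} \<in> H} \<le> card {k\<in>I. {(v, k), (u, c u)} \<in> H}"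
          using finI k(1) by (intro card_inj_on_le[of "\<lambda>_. k"]) (auto simp: inj_on_def)
        then show ?thesis using False by (simp add: reduced_def F'_def)
      qed
      then have "\<exists>d zs. F_colouring H s F ({v} \<union> W) d zs"
        using I(1,3) k(1) WV(2) by (intro F_colouring_union[OF F_colouring_singleton[of k s F v H] c]) auto
      then show ?thesis by (simp add: GX)
    qed
    have nbX: "card {w\<in>X. {w, v} \<in> E} \<le> 2" using X(2) card_mono[OF finX, of "{w\<in>X. {w, v} \<in> E}"] by auto
    have sumv: "3 \<le> (\<Sum>i=1..s. F i v) + card {w\<in>X. {w, v} \<in> E}" using Fsum[of v] v vG(1) by simp
    show ?thesis
    proof (cases "\<exists>w\<in>W \<inter> ?S. {v, w} \<in> E")
      \<comment> \<open>Both members of X may be adjacent to v, so only one unit is certain. It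
        suffices, as there is no uncoloured outer neighbour to clash with.\<close>
      case False
      have "(\<Sum>i=1..s. F i v) \<noteq> 0" using nbX sumv by linarith
      then obtain k where k: "k \<in> {1..s}" "0 < F k v" by (rule sum_posE)
      show ?thesis
      proof (rule reserve[of "{k}"])
        have "{(v, k), (u, c u)} \<notin> H" if "u \<in> W \<inter> ?S" for u and c :: "'a \<Rightarrow> nat"
          using False cover_edge[of v u k "c u"] that vG(2) WV by blast
        then show "\<exists>k\<in>{k}. \<forall>u\<in>W \<inter> ?S. {(v, k), (u, c u)} \<notin> H" for c by simp
      qed (use k in auto)
    next
      case True
      then obtain w where w: "w \<in> W" "w \<in> ?S" "{v, w} \<in> E" by blast
      have wX: "w \<notin> X" using w by (auto simp: W_def)
      have only: "u = w" if "u \<in> W \<inter> ?S" "{v, u} \<in> E" for u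
        using leaf[of u w] that w x by (auto simp: W_def)
      \<comment> \<open>The only neighbour that v may have among the outer vertices other than x is
        w, so the second member of X is not adjacent to v.\<close>
      have "{u\<in>X. {u, v} \<in> E} \<subseteq> {x}"
      proof
        fix u assume "u \<in> {u\<in>X. {u, v} \<in> E}"
        then have u: "u \<in> X" "{v, u} \<in> E" by (auto simp: insert_commute)
        then show "u \<in> {x}" using leaf[of u w] w wX X(1) x by auto
      qed
      then have "card {u\<in>X. {u, v} \<in> E} \<le> 1" using card_mono[of "{x}"] by fastforce
      then have "2 \<le> (\<Sum>i=1..s. F i v)" using sumv by linarith
      then consider (one) k where "k \<in> {1..s}" "F k v \<ge> 2"
        | (two) k l where "k \<in> {1..s}" "l \<in> {1..s}" "k \<noteq> l" "F k v \<ge> 1" "F l v \<ge> 1"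
        by (rule sum_ge_2_cases[OF finite_atLeastAtMost]) 
      then show ?thesis
      proof cases
        case two
        show ?thesis
        proof (rule reserve[of "{k, l}"])
          fix c :: "'a \<Rightarrow> nat" assume c: "\<And>u. u \<in> W \<Longrightarrow> c u \<in> {1..s}"
          have "\<not> ({(v, k), (w, c w)} \<in> H \<and> {(v, l), (w, c w)} \<in> H)"
            using cover_unique[of w v "c w" k l] c[OF w(1)] two w(1) WV vG(2) by (auto simp: insert_commute)
          then obtain j where j: "j \<in> {k, l}" "{(v, j), (w, c w)} \<notin> H" by blast
          have "{(v, j), (u, c u)} \<notin> H" if "u \<in> W \<inter> ?S" for u
            using only[of u] cover_edge[of v u j "c u"] j(2) that WV vG(2) by blast
          then show "\<exists>j\<in>{k, l}. \<forall>u\<in>W \<inter> ?S. {(v, j), (u, c u)} \<notin> H" using j(1) by blast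
        qed (use two in \<open>auto simp: card_insert_if\<close>)
      next
        case one
        \<comment> \<open>Inner vertices lose the colour matched with \<open>(v, k)\<close>
          completely, not just one unit: v will come last, and its single admissible earlier
          neighbour is w.\<close>
        define F' where "F' i u = (if u \<notin> ?S \<and> {(v, k), (u, i)} \<in> H then 0 else F i u)" for i u
        have "\<exists>c xs. F_colouring H s F' W c xs"
        proof (rule recurse)
          show "F' i u \<le> F i u" "u \<in> ?S \<Longrightarrow> F' i u = F i u" for i u by (auto simp: F'_def)
          show "F' i u = F i u" if "u \<in> W" "{v, u} \<notin> E" for i u
            using cover_edge[of v u k i] that vG WV by (auto simp: F'_def)
          show "(\<Sum>i=1..s. F i u) \<le> (\<Sum>i=1..s. F' i u) + 2" if "u \<in> W" for u
          proof -
            have uG: "u \<in> G" using that WV by blast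
            have "(\<Sum>i=1..s. F i u) \<le> (\<Sum>i=1..s. F' i u + 2 * card {j\<in>{k}. {(v, j), (u, i)} \<in> H})"
            proof (intro sum_mono)
              fix i assume i: "i \<in> {1..s}"
              have "{j\<in>{k}. {(v, j), (u, i)} \<in> H} = (if {(v, k), (u, i)} \<in> H then {k} else {})" by auto
              then show "F i u \<le> F' i u + 2 * card {j\<in>{k}. {(v, j), (u, i)} \<in> H}"
                using F2[OF uG i] by (auto simp: F'_def)
            qed
            also have "\<dots> = (\<Sum>i=1..s. F' i u) + 2 * (\<Sum>i=1..s. card {j\<in>{k}. {(v, j), (u, i)} \<in> H})"
              by (simp add: sum.distrib sum_distrib_left)
            also have "(\<Sum>i=1..s. card {j\<in>{k}. {(v, j), (u, i)} \<in> H}) \<le> card {j\<in>{k}. \<exists>i\<in>{1..s}. {(v, j), (u, i)} \<in> H}"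
              using cover_unique[of v u k] that vG WV one(1) by (intro sum_card_le) blast+
            also have "\<dots> \<le> card {k}" by (intro card_mono) auto
            finally show ?thesis by simp
          qed
        qed
        then obtain c xs where c: "F_colouring H s F' W c xs" by blast
        have sub: "{u\<in>W. {(u, c u), (v, k)} \<in> H} \<subseteq> {w}"
        proof
          fix u assume "u \<in> {u\<in>W. {(u, c u), (v, k)} \<in> H}"
          then have u: "u \<in> W" "{(v, k), (u, c u)} \<in> H" by (auto simp: insert_commute)
          have "u \<in> ?S" using F_colouring_pos[OF c u(1)] u(2) by (auto simp: F'_def split: if_splits)
          moreover have "{v, u} \<in> E" using cover_edge[of v u] u WV vG(2) by blast
          ultimately show "u \<in> {w}" using only[of u] u(1) by simp
        qed
        have "\<exists>d zs. F_colouring H s F (W \<union> {v}) d zs"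
        proof (rule F_colouring_union)
          have "degenerate_order H F c xs" if "degenerate_order H F' c xs" for xs
            using that by (induction xs) (auto simp: F'_def split: if_splits)
          then show "F_colouring H s F W c xs" using c by (auto simp: F_colouring_def)
          \<comment> \<open>Weight 1 is what remains for v: two units minus at most one clash, with
            w.\<close>
          show "F_colouring H s (\<lambda>_ _. 1) {v} (\<lambda>_. k) [v]" by (rule F_colouring_singleton[OF one(1)]) simp
          have "card {u\<in>W. {(u, c u), (v, k)} \<in> H} \<le> 1" using card_mono[OF _ sub] by simp
          then show "1 \<le> reduced H F c W k u" if "u \<in> {v}" for u using that one(2) by (simp add: reduced_def)
        qed (use WV in auto)
        then show ?thesis by (simp add: GX)
      qed
    qed
  qed
qed

end

subsection \<open>Covers, list colourings and partitions\<close>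

lemma planar_F_colouring:
  assumes "planar_graph V E" "is_cover V E (\<lambda>v. {1..s}) H"
    and "\<And>v i. v \<in> V \<Longrightarrow> i \<in> {1..s} \<Longrightarrow> F i v \<le> 2" "\<And>v. v \<in> V \<Longrightarrow> 5 \<le> (\<Sum>i=1..s. F i v)"
  shows "\<exists>c xs. F_colouring H s F V c xs"
proof -
  obtain p \<gamma> where "simple_graph V E" "planar_embedding V E p \<gamma>"
    using assms(1) unfolding planar_graph_def by blast
  then interpret plane_cover V E p \<gamma> s H
    using assms(2) by unfold_locales
  have "\<exists>c xs. F_colouring H s F (V - {}) c xs"
    using assms(3,4) by (intro extend_colouring[of "{}"]) (auto simp: connected_set_empty clique_def outer_def joined_def)
  then show ?thesis by simp
qed

lemma planar_list_F_colouring: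
  assumes planar: "planar_graph V E" and H: "is_cover V E L H"
    and L: "\<And>v. v \<in> V \<Longrightarrow> finite (L v) \<and> 0 \<notin> L v"
    and F: "\<And>v i. v \<in> V \<Longrightarrow> i \<in> L v \<Longrightarrow> F i v \<le> 2" "\<And>v. v \<in> V \<Longrightarrow> 5 \<le> (\<Sum>i\<in>L v. F i v)"
  obtains c xs where "distinct xs" "set xs = V" "\<And>v. v \<in> V \<Longrightarrow> c v \<in> L v" "degenerate_order H F c xs"
proof -
  have fin: "finite (\<Union>v\<in>V. L v)" using planar L by (auto simp: planar_graph_def simple_graph_def)
  define s where "s = Max (insert 0 (\<Union>v\<in>V. L v))"
  have Ls: "L v \<subseteq> {1..s}" if "v \<in> V" for v
  proof
    fix i assume i: "i \<in> L v"
    then have "i \<le> s" unfolding s_def using that fin by (intro Max_ge) auto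
    moreover have "i \<noteq> 0" using i L[OF that] by metis
    ultimately show "i \<in> {1..s}" by simp
  qed
  define H' where "H' = H \<union> {{(u, i), (u, j)} | u i j. u \<in> V \<and> i \<in> {1..s} \<and> j \<in> {1..s} \<and> i \<noteq> j}"
  have H'_iff: "{(u, i), (v, j)} \<in> H' \<longleftrightarrow> {(u, i), (v, j)} \<in> H" if "u \<noteq> v" for u v i j
    using that by (auto simp: H'_def doubleton_eq_iff)
  have Hin: "i \<in> L u \<and> j \<in> L v" if "{(u, i), (v, j)} \<in> H" for u v i j
  proof -
    have "\<forall>e\<in>H. \<exists>x y. e = {x, y} \<and> x \<noteq> y \<and> x \<in> Sigma V L \<and> y \<in> Sigma V L"
      using H unfolding is_cover_def by (elim conjE)
    from bspec[OF this that] show ?thesis by (auto simp: doubleton_eq_iff)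
  qed
  have noloop: "{u, v} \<in> E \<Longrightarrow> u \<noteq> v" for u v
    using planar simple_graph_edge unfolding planar_graph_def by metis
  define F' where "F' i v = (if i \<in> L v then F i v else 0)" for i v
  have "is_cover V E (\<lambda>v. {1..s}) H'"
    unfolding is_cover_def
  proof (intro conjI)
    show "\<forall>e\<in>H'. \<exists>x y. e = {x, y} \<and> x \<noteq> y \<and> x \<in> V \<times> {1..s} \<and> y \<in> V \<times> {1..s}"
    proof
      fix e assume "e \<in> H'"
      then consider "e \<in> H" | u i j where "e = {(u, i), (u, j)}" "u \<in> V" "i \<in> {1..s}" "j \<in> {1..s}" "i \<noteq> j"
        unfolding H'_def by blast
      then show "\<exists>x y. e = {x, y} \<and> x \<noteq> y \<and> x \<in> V \<times> {1..s} \<and> y \<in> V \<times> {1..s}"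
      proof cases
        case 1
        have "\<forall>e\<in>H. \<exists>x y. e = {x, y} \<and> x \<noteq> y \<and> x \<in> Sigma V L \<and> y \<in> Sigma V L"
          using H unfolding is_cover_def by (elim conjE)
        then obtain x y where "e = {x, y}" "x \<noteq> y" "x \<in> Sigma V L" "y \<in> Sigma V L" using 1 by meson
        then show ?thesis using Ls by (intro exI[of _ x] exI[of _ y]) auto
      next
        case 2
        then show ?thesis by (intro exI[of _ "(u, i)"] exI[of _ "(u, j)"]) auto
      qed
    qed
    show "\<forall>u\<in>V. \<forall>c\<in>{1..s}. \<forall>d\<in>{1..s}. c \<noteq> d \<longrightarrow> {(u, c), (u, d)} \<in> H'"
      unfolding H'_def by blast
    have "\<forall>u\<in>V. \<forall>v\<in>V. {u, v} \<in> E \<longrightarrow> (\<forall>c\<in>L u. \<forall>d1\<in>L v. \<forall>d2\<in>L v.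
           {(u, c), (v, d1)} \<in> H \<longrightarrow> {(u, c), (v, d2)} \<in> H \<longrightarrow> d1 = d2)"
      using H unfolding is_cover_def by (elim conjE)
    then show "\<forall>u\<in>V. \<forall>v\<in>V. {u, v} \<in> E \<longrightarrow> (\<forall>c\<in>{1..s}. \<forall>d1\<in>{1..s}. \<forall>d2\<in>{1..s}.
           {(u, c), (v, d1)} \<in> H' \<longrightarrow> {(u, c), (v, d2)} \<in> H' \<longrightarrow> d1 = d2)"
      using H'_iff noloop Hin by metis
    have "\<forall>u\<in>V. \<forall>v\<in>V. \<forall>c d. u \<noteq> v \<longrightarrow> {(u, c), (v, d)} \<in> H \<longrightarrow> {u, v} \<in> E"
      using H unfolding is_cover_def by (elim conjE)
    then show "\<forall>u\<in>V. \<forall>v\<in>V. \<forall>c d. u \<noteq> v \<longrightarrow> {(u, c), (v, d)} \<in> H' \<longrightarrow> {u, v} \<in> E"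
      using H'_iff by metis
  qed
  then have "\<exists>c xs. F_colouring H' s F' V c xs"
  proof (rule planar_F_colouring[OF planar])
    show "F' i v \<le> 2" if "v \<in> V" "i \<in> {1..s}" for v i using F(1) that by (simp add: F'_def)
    have "(\<Sum>i=1..s. F' i v) = (\<Sum>i\<in>L v. F i v)" if "v \<in> V" for v
      using Ls[OF that] by (intro sum.mono_neutral_cong_right) (auto simp: F'_def)
    then show "5 \<le> (\<Sum>i=1..s. F' i v)" if "v \<in> V" for v using F(2) that by metis
  qed
  then obtain c xs where c: "F_colouring H' s F' V c xs" by blast
  have cL: "c v \<in> L v" if "v \<in> V" for v
    using F_colouring_pos[OF c that] by (auto simp: F'_def split: if_splits)
  have conv: "degenerate_order H F c ys" if "degenerate_order H' F' c ys" "distinct ys" "set ys \<subseteq> V" for ys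
    using that
  proof (induction ys)
    case (Cons v ys)
    have "({(u, c u), (v, c v)} \<in> H') = ({(u, c u), (v, c v)} \<in> H)" if "u \<in> set ys" for u
      using Cons.prems(2) that by (intro H'_iff) auto
    then have "{u\<in>set ys. {(u, c u), (v, c v)} \<in> H'} = {u\<in>set ys. {(u, c u), (v, c v)} \<in> H}"
      by blast
    then show ?case using Cons cL by (simp add: F'_def)
  qed simp
  show ?thesis
    using c cL conv by (intro that[of xs c]) (auto simp: F_colouring_def)
qed

text \<open>A vertex of weight at most 1 has no earlier neighbour, so the later of u and v rules out
  the edge.\<close>

lemma back_bounded_no_edge:
  assumes "back_bounded R g xs" "u \<in> set xs" "v \<in> set xs" "u \<noteq> v" "g u \<le> 1" "g v \<le> 1" "\<And>x y. R x y = R y x"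
  shows "\<not> R u v"
  using assms(1-4)
proof (induction xs)
  case (Cons w xs)
  have last: "\<not> R x w" if "x \<in> set xs" "g w \<le> 1" for x
  proof -
    have "card {u\<in>set xs. R u w} < g w" using Cons.prems(1) by simp
    then have "card {u\<in>set xs. R u w} = 0" using that(2) by linarith
    then have "{u\<in>set xs. R u w} = {}" by simp
    then show ?thesis using that(1) by blast
  qed
  show ?case
    using Cons assms(5,6,7) last by auto
qed simp

text \<open>Each vertex has at most one earlier neighbour, but the last vertex of a cycle would have
  two. The map \<open>h\<close> covers both vertices of G and chosen vertices of a cover.\<close>

lemma back_bounded_forest:
  assumes "back_bounded (\<lambda>u v. {h u, h v} \<in> H) g xs" "inj_on h (set xs)" "\<And>v. v \<in> set xs \<Longrightarrow> g v \<le> 2"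
  shows "induces_forest H (h ` set xs)"
  using assms
proof (induction xs)
  case Nil
  then show ?case by (simp add: induces_forest_def)
next
  case (Cons v xs)
  have IH: "induces_forest H (h ` set xs)" using Cons by (auto simp: inj_on_def)
  show ?case
    unfolding induces_forest_def
  proof
    assume "\<exists>cs. 3 \<le> length cs \<and> distinct cs \<and> set cs \<subseteq> h ` set (v # xs)
      \<and> (\<forall>k<length cs. {cs ! k, cs ! ((k + 1) mod length cs)} \<in> H)"
    then obtain cs where cs: "3 \<le> length cs" "distinct cs" "set cs \<subseteq> h ` set (v # xs)"
      "\<And>k. k < length cs \<Longrightarrow> {cs ! k, cs ! ((k + 1) mod length cs)} \<in> H" by blast
    have "\<not> set cs \<subseteq> h ` set xs"
      using IH cs unfolding induces_forest_def by blast
    then have "h v \<in> set cs" "h v \<notin> h ` set xs" using cs(3) by auto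
    then obtain k where k: "k < length cs" "cs ! k = h v" by (auto simp: in_set_conv_nth)
    define n where "n = length cs"
    define a where "a = (k + 1) mod n"
    \<comment> \<open>The predecessor of k on the cycle; adding n first avoids truncation at
      \<open>k = 0\<close>. Length at least 3 separates a from b.\<close>
    define b where "b = (k + n - 1) mod n"
    have n: "3 \<le> n" "k < n" using cs(1) k(1) by (auto simp: n_def)
    have a: "a = (if k + 1 = n then 0 else k + 1)" using n by (auto simp: a_def)
    have b: "b = (if k = 0 then n - 1 else k - 1)"
    proof (cases "k = 0")
      case False
      then have "k + n - 1 = (k - 1) + n" by simp
      then have "b = (k - 1) mod n" unfolding b_def by (simp only: mod_add_self2)
      then show ?thesis using n False by simp
    qed (use n in \<open>simp add: b_def\<close>)
    have ab: "a < n" "b < n" "a \<noteq> b" "a \<noteq> k" "b \<noteq> k" "(b + 1) mod n = k" using n unfolding a b by auto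
    have "{cs ! a, h v} \<in> H" using cs(4)[OF k(1)] k(2) by (simp add: a_def n_def insert_commute)
    moreover have "{cs ! b, h v} \<in> H" using cs(4)[of b] ab k(2) by (simp add: n_def)
    moreover have neq: "cs ! a \<noteq> cs ! b" "cs ! a \<noteq> h v" "cs ! b \<noteq> h v"
      using ab n k cs(2) by (auto simp: n_def nth_eq_iff_index_eq simp flip: k(2))
    moreover have "cs ! a \<in> h ` set (v # xs)" "cs ! b \<in> h ` set (v # xs)"
      using ab cs(3) by (auto simp: n_def dest: nth_mem)
    ultimately obtain x y where xy: "x \<in> set xs" "y \<in> set xs" "cs ! a = h x" "cs ! b = h y" "{h x, h v} \<in> H" "{h y, h v} \<in> H"
      by auto
    have "{x, y} \<subseteq> {u\<in>set xs. {h u, h v} \<in> H}" using xy by auto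
    then have "card {x, y} \<le> card {u\<in>set xs. {h u, h v} \<in> H}" by (intro card_mono) auto
    moreover have "x \<noteq> y" using xy(3,4) neq(1) by auto
    then have "card {x, y} = 2" by simp
    ultimately show False using Cons.prems(1,3) by fastforce
  qed
qed

lemma back_bounded_filter:
  assumes "back_bounded R g xs" "\<And>u v. P u \<Longrightarrow> P v \<Longrightarrow> u \<in> set xs \<Longrightarrow> v \<in> set xs \<Longrightarrow> R u v = Q u v"
    "\<And>v. v \<in> set xs \<Longrightarrow> P v \<Longrightarrow> g v = g' v"
  shows "back_bounded Q g' (filter P xs)"
  using assms
proof (induction xs)
  case (Cons v xs)
  have IH: "back_bounded Q g' (filter P xs)" using Cons by auto
  show ?case
  proof (cases "P v")
    case True
    have "card {u\<in>set (filter P xs). Q u v} \<le> card {u\<in>set xs. R u v}"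
      using Cons.prems(2)[OF _ True] by (intro card_mono) auto
    then show ?thesis using True IH Cons.prems(1) Cons.prems(3)[OF _ True] by simp
  qed (use IH in simp)
qed simp

text \<open>Passes from the reversed lists to the indexed orders in the definitions, where earlier
  vertices have smaller indices.\<close>

lemma back_bounded_nth:
  assumes "back_bounded R g xs" "distinct xs" "k < length xs"
  shows "card {j. j < k \<and> R (rev xs ! j) (rev xs ! k)} < g (rev xs ! k)"
  using assms
proof (induction xs)
  case (Cons v xs)
  show ?case
  proof (cases "k < length xs")
    case True
    then have "{j. j < k \<and> R (rev (v # xs) ! j) (rev (v # xs) ! k)} = {j. j < k \<and> R (rev xs ! j) (rev xs ! k)}"
      by (auto simp: nth_append)
    then show ?thesis using Cons True by (simp add: nth_append)
  next
    case False
    then have k: "k = length xs" using Cons.prems(3) by simp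
    have "card {j. j < k \<and> R (rev (v # xs) ! j) v} \<le> card {u\<in>set xs. R u v}"
    proof (rule card_inj_on_le[of "nth (rev xs)"])
      show "inj_on ((!) (rev xs)) {j. j < k \<and> R (rev (v # xs) ! j) v}"
        using Cons.prems(2) k by (auto simp: inj_on_def nth_eq_iff_index_eq)
      show "(!) (rev xs) ` {j. j < k \<and> R (rev (v # xs) ! j) v} \<subseteq> {u\<in>set xs. R u v}"
        using k by (auto simp: nth_append) (metis length_rev nth_mem set_rev)
    qed simp
    then show ?thesis using Cons.prems(1) k by (simp add: nth_append)
  qed
qed simp

text \<open>The cover whose colourings are ordinary list colourings: different vertices conflict
  only along an edge and in the same colour. The second set supplies the cliques that
  \<open>is_cover\<close> demands.\<close>

definition same_colour_cover :: "'a set \<Rightarrow> 'a set set \<Rightarrow> ('a \<Rightarrow> nat set) \<Rightarrow> ('a \<times> nat) set set" where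
  "same_colour_cover V E L =
     {{(u, i), (v, i)} | u v i. {u, v} \<in> E \<and> i \<in> L u \<and> i \<in> L v} \<union>
     {{(u, i), (u, j)} | u i j. u \<in> V \<and> i \<in> L u \<and> j \<in> L u \<and> i \<noteq> j}"

lemma same_colour_cover_iff:
  assumes "u \<noteq> v"
  shows "{(u, i), (v, j)} \<in> same_colour_cover V E L \<longleftrightarrow> {u, v} \<in> E \<and> i = j \<and> i \<in> L u \<and> i \<in> L v"
proof
  assume "{(u, i), (v, j)} \<in> same_colour_cover V E L"
  then show "{u, v} \<in> E \<and> i = j \<and> i \<in> L u \<and> i \<in> L v"
    using assms unfolding same_colour_cover_def by (auto simp: doubleton_eq_iff insert_commute)
qed (auto simp: same_colour_cover_def)

lemma is_cover_same_colour:
  assumes "simple_graph V E"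
  shows "is_cover V E L (same_colour_cover V E L)"
  unfolding is_cover_def
proof (intro conjI)
  show "\<forall>e\<in>same_colour_cover V E L. \<exists>x y. e = {x, y} \<and> x \<noteq> y \<and> x \<in> Sigma V L \<and> y \<in> Sigma V L"
  proof
    fix e assume "e \<in> same_colour_cover V E L"
    then consider u v i where "e = {(u, i), (v, i)}" "{u, v} \<in> E" "i \<in> L u" "i \<in> L v"
      | u i j where "e = {(u, i), (u, j)}" "u \<in> V" "i \<in> L u" "j \<in> L u" "i \<noteq> j"
      unfolding same_colour_cover_def by blast
    then show "\<exists>x y. e = {x, y} \<and> x \<noteq> y \<and> x \<in> Sigma V L \<and> y \<in> Sigma V L"
    proof cases
      case 1
      then show ?thesis using simple_graph_edge[OF assms 1(2)] by (intro exI[of _ "(u, i)"] exI[of _ "(v, i)"]) auto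
    next
      case 2
      then show ?thesis by (intro exI[of _ "(u, i)"] exI[of _ "(u, j)"]) auto
    qed
  qed
  show "\<forall>u\<in>V. \<forall>c\<in>L u. \<forall>d\<in>L u. c \<noteq> d \<longrightarrow> {(u, c), (u, d)} \<in> same_colour_cover V E L"
    unfolding same_colour_cover_def by blast
  show "\<forall>u\<in>V. \<forall>v\<in>V. {u, v} \<in> E \<longrightarrow> (\<forall>c\<in>L u. \<forall>d1\<in>L v. \<forall>d2\<in>L v.
     {(u, c), (v, d1)} \<in> same_colour_cover V E L \<longrightarrow> {(u, c), (v, d2)} \<in> same_colour_cover V E L \<longrightarrow> d1 = d2)"
    using simple_graph_edge[OF assms] by (metis same_colour_cover_iff)
  show "\<forall>u\<in>V. \<forall>v\<in>V. \<forall>c d. u \<noteq> v \<longrightarrow> {(u, c), (v, d)} \<in> same_colour_cover V E L \<longrightarrow> {u, v} \<in> E"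
    by (simp add: same_colour_cover_iff)
qed

text \<open>Inside one colour class, adjacency in this cover is adjacency in G, so the order
  restricts to the subgraph induced by the class.\<close>

lemma colour_class_order:
  assumes simple: "simple_graph V E" and order: "degenerate_order (same_colour_cover V E L) F c xs"
    and L: "\<And>v. v \<in> set xs \<Longrightarrow> c v \<in> L v"
  shows "back_bounded (\<lambda>u v. {u, v} \<in> E) (F i) (filter (\<lambda>v. c v = i) xs)"
  using order
proof (rule back_bounded_filter)
  fix u v assume uv: "c u = i" "c v = i" "u \<in> set xs" "v \<in> set xs"
  show "({(u, c u), (v, c v)} \<in> same_colour_cover V E L) = ({u, v} \<in> E)"
  proof (cases "u = v")
    case True
    have "{(u, c u)} \<notin> same_colour_cover V E L" unfolding same_colour_cover_def
      using simple_graph_loopfree[OF simple] by (auto simp: singleton_insert_inj_eq)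
    then show ?thesis using True simple_graph_loopfree[OF simple] by simp
  next
    case False
    then show ?thesis using L[of u] L[of v] uv by (simp add: same_colour_cover_iff)
  qed
qed simp

section \<open>The individual assertions\<close>

lemma representative_graph:
  assumes "\<And>v. v \<in> V \<Longrightarrow> c v \<in> L v"
  shows "representative_set V L ((\<lambda>v. (v, c v)) ` V)"
  using assms unfolding representative_set_def by auto

lemma planar_DPG_colorable:
  fixes V :: "'a set"
  assumes "planar_graph V E"
  shows "DPG_colorable V E 5 2"
  unfolding DPG_colorable_def
proof (intro allI impI)
  fix s :: nat and H and F :: "nat \<Rightarrow> 'a \<Rightarrow> nat"
  assume H: "is_cover V E (\<lambda>v. {1..s}) H" and F: "\<forall>v\<in>V. 5 \<le> (\<Sum>i=1..s. F i v)" "\<forall>v\<in>V. \<forall>i\<in>{1..s}. F i v \<le> 2"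
  obtain c xs where c: "F_colouring H s F V c xs"
    using planar_F_colouring[OF assms H, of F] F by blast
  then have xs: "distinct xs" "set xs = V" "\<And>v. v \<in> V \<Longrightarrow> c v \<in> {1..s}" "degenerate_order H F c xs"
    unfolding F_colouring_def by auto
  let ?h = "\<lambda>v. (v, c v)"
  let ?ys = "map ?h (rev xs)"
  have "card {j. j < k \<and> {?ys ! j, ?ys ! k} \<in> H} < F (snd (?ys ! k)) (fst (?ys ! k))" if k: "k < length ?ys" for k
  proof -
    have "{j. j < k \<and> {?ys ! j, ?ys ! k} \<in> H} = {j. j < k \<and> {?h (rev xs ! j), ?h (rev xs ! k)} \<in> H}"
      using k by auto
    then show ?thesis using back_bounded_nth[OF xs(4,1), of k] k by simp
  qed
  moreover have "distinct ?ys" "set ?ys = ?h ` V" using xs(1,2) by (auto simp: distinct_map inj_on_def)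
  ultimately show "\<exists>R. DP_F_coloring V (\<lambda>v. {1..s}) H F R"
    using representative_graph[of V c "\<lambda>v. {1..s}"] xs(3) unfolding DP_F_coloring_def by blast
qed

lemma planar_DP_5_colorable:
  assumes "planar_graph V E"
  shows "DP_k_colorable V E 5"
  unfolding DP_k_colorable_def
proof (intro allI impI)
  fix L H assume L: "k_assignment V 5 L" and H: "is_cover V E L H"
  \<comment> \<open>Five colours of weight 1: no chosen vertex may have an earlier
    neighbour.\<close>
  obtain c xs where c: "distinct xs" "set xs = V" "\<And>v. v \<in> V \<Longrightarrow> c v \<in> L v" "degenerate_order H (\<lambda>_ _. 1) c xs"
    by (rule planar_list_F_colouring[OF assms H, of "\<lambda>_ _. 1"]) (use L in \<open>auto simp: k_assignment_def\<close>)
  have "{(u, c u), (v, c v)} \<notin> H" if "u \<in> V" "v \<in> V" for u v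
  proof (cases "u = v")
    case False
    then show ?thesis
      using back_bounded_no_edge[OF c(4)] c(2) that by (simp add: insert_commute)
  next
    case True
    have "\<forall>e\<in>H. \<exists>x y. e = {x, y} \<and> x \<noteq> y \<and> x \<in> Sigma V L \<and> y \<in> Sigma V L"
      using H unfolding is_cover_def by (elim conjE)
    then show ?thesis using True by (metis doubleton_eq_iff insert_absorb2)
  qed
  then have "independent_set H ((\<lambda>v. (v, c v)) ` V)" unfolding independent_set_def by auto
  then show "\<exists>R. DP_coloring V L H R"
    using representative_graph[of V c L] c(3) unfolding DP_coloring_def by blast
qed

lemma planar_DP_3_arborable:
  assumes "planar_graph V E"
  shows "DP_vertex_arborable V E 3"
  unfolding DP_vertex_arborable_def
proof (intro allI impI)
  fix L H assume L: "k_assignment V 3 L" and H: "is_cover V E L H"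
  \<comment> \<open>Three colours of weight 2, with total 6: each chosen vertex may have one earlier
    neighbour.\<close>
  obtain c xs where c: "distinct xs" "set xs = V" "\<And>v. v \<in> V \<Longrightarrow> c v \<in> L v" "degenerate_order H (\<lambda>_ _. 2) c xs"
    by (rule planar_list_F_colouring[OF assms H, of "\<lambda>_ _. 2"]) (use L in \<open>auto simp: k_assignment_def\<close>)
  have "induces_forest H ((\<lambda>v. (v, c v)) ` V)"
    using back_bounded_forest[OF c(4)] c(2) by (auto simp: inj_on_def)
  then show "\<exists>R. DP_forested_coloring V L H R"
    using representative_graph[of V c L] c(3) unfolding DP_forested_coloring_def by blast
qed

lemma planar_5_choosable:
  assumes "planar_graph V E"
  shows "choosable V E 5"
  unfolding choosable_def
proof (intro allI impI)
  fix L assume L: "k_assignment V 5 L"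
  have simple: "simple_graph V E" using assms by (simp add: planar_graph_def)
  obtain R where R: "DP_coloring V L (same_colour_cover V E L) R"
    using planar_DP_5_colorable[OF assms] L is_cover_same_colour[OF simple] unfolding DP_k_colorable_def by blast
  then have "\<forall>v\<in>V. \<exists>i. (v, i) \<in> R" "R \<subseteq> Sigma V L"
    unfolding DP_coloring_def representative_set_def by blast+
  then obtain c where c: "\<And>v. v \<in> V \<Longrightarrow> (v, c v) \<in> R \<and> c v \<in> L v" by (metis (no_types) mem_Sigma_iff subsetD)
  have "c u \<noteq> c v" if "u \<in> V" "v \<in> V" "{u, v} \<in> E" for u v
  proof
    assume "c u = c v"
    then have "{(u, c u), (v, c v)} \<in> same_colour_cover V E L"
      using that c simple_graph_edge[OF simple that(3)] by (simp add: same_colour_cover_iff) metis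
    then show False using R c that unfolding DP_coloring_def independent_set_def by blast
  qed
  then show "\<exists>c. proper_L_coloring V E L c" using c unfolding proper_L_coloring_def by blast
qed

text \<open>Weight 1 makes a class independent and weight 2 makes it a forest. A list then weighs at
  least \<open>2 * k - card I\<close>, which is 5 both for k = 4 with three colours in I and for k =
  3 with one.\<close>

lemma planar_forested_coloring:
  assumes planar: "planar_graph V E" and L: "k_assignment V k L"
    and I: "finite I" "card I + 5 \<le> 2 * k"
  shows "\<exists>c. L_forested_coloring V E L c \<and> (\<forall>i\<in>I. independent_set E (color_class V c i))"
proof -
  have simple: "simple_graph V E" using planar by (simp add: planar_graph_def)
  let ?H = "same_colour_cover V E L" and ?F = "\<lambda>i (v :: 'a). if i \<in> I then 1 else 2 :: nat"
  have sum: "5 \<le> (\<Sum>i\<in>L v. ?F i v)" if "v \<in> V" for v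
  proof -
    have Lv: "finite (L v)" "card (L v) = k" using L that by (auto simp: k_assignment_def)
    have "2 * k = (\<Sum>i\<in>L v. 2)" using Lv by simp
    also have "\<dots> = (\<Sum>i\<in>L v. ?F i v + (if i \<in> I then 1 else 0))" by (intro sum.cong) auto
    also have "\<dots> = (\<Sum>i\<in>L v. ?F i v) + card (L v \<inter> I)"
      using Lv by (simp add: sum.distrib sum.If_cases Int_def)
    also have "card (L v \<inter> I) \<le> card I" using I(1) by (intro card_mono) auto
    finally show ?thesis using I(2) by simp
  qed
  obtain c xs where c: "distinct xs" "set xs = V" "\<And>v. v \<in> V \<Longrightarrow> c v \<in> L v" "degenerate_order ?H ?F c xs"
    by (rule planar_list_F_colouring[OF planar is_cover_same_colour[OF simple, of L], of ?F])
      (use L sum in \<open>auto simp: k_assignment_def\<close>)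
  have edge: "{(u, c u), (v, c v)} \<in> ?H \<longleftrightarrow> {u, v} \<in> E"
    if "u \<in> color_class V c i" "v \<in> color_class V c i" "u \<noteq> v" for u v i
    using that c(3)[of u] c(3)[of v] by (auto simp: same_colour_cover_iff color_class_def)
  have "induces_forest E (color_class V c i)" for i
  proof -
    let ?ys = "filter (\<lambda>v. c v = i) xs"
    have "set ?ys = color_class V c i" using c(2) by (auto simp: color_class_def)
    then show ?thesis
      using back_bounded_forest[where h = "\<lambda>v. v", OF colour_class_order[OF simple, where F = ?F and i = i, OF c(4)]] c(2,3)
      by auto
  qed
  moreover have "independent_set E (color_class V c i)" if "i \<in> I" for i
    unfolding independent_set_def
  proof (intro ballI)
    fix u v assume uv: "u \<in> color_class V c i" "v \<in> color_class V c i"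
    show "{u, v} \<notin> E"
    proof (cases "u = v")
      case True then show ?thesis using simple_graph_edge[OF simple, of u v] by blast
    next
      case False
      have "u \<in> set xs" "v \<in> set xs" "c u = i" "c v = i" using uv c(2) by (auto simp: color_class_def)
      then have "{(u, c u), (v, c v)} \<notin> ?H"
        using back_bounded_no_edge[OF c(4) _ _ False] that by (simp add: insert_commute)
      then show ?thesis using edge[OF uv False] by simp
    qed
  qed
  ultimately show ?thesis using c(3) unfolding L_forested_coloring_def by blast
qed

lemma planar_F_partition:
  assumes planar: "planar_graph V E" 
    and F: "\<forall>v\<in>V. \<forall>i\<in>{1..s}. F i v \<le> 2" "\<forall>v\<in>V. 5 \<le> (\<Sum>i=1..s. F i v)"
  shows "has_F_partition V E s F"
proof -
  have simple: "simple_graph V E" using planar by (simp add: planar_graph_def)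
  let ?H = "same_colour_cover V E (\<lambda>v. {1..s})"
  obtain c xs where "F_colouring ?H s F V c xs"
    using planar_F_colouring[OF planar is_cover_same_colour[OF simple], of s F] F by blast
  then have c: "distinct xs" "set xs = V" "\<And>v. v \<in> V \<Longrightarrow> c v \<in> {1..s}" "degenerate_order ?H F c xs"
    unfolding F_colouring_def by auto
  have "strictly_degenerate E {v\<in>V. c v = i} (F i)" for i
  proof -
    let ?ys = "filter (\<lambda>v. c v = i) xs"
    have "back_bounded (\<lambda>u v. {u, v} \<in> E) (F i) ?ys"
      using colour_class_order[OF simple, where F = F, OF c(4)] c(2,3) by simp
    then have "\<forall>k<length (rev ?ys). card {j. j < k \<and> {rev ?ys ! j, rev ?ys ! k} \<in> E} < F i (rev ?ys ! k)"
      using back_bounded_nth[of "\<lambda>u v. {u, v} \<in> E" "F i" ?ys] c(1) by simp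
    moreover have "distinct (rev ?ys)" "set (rev ?ys) = {v\<in>V. c v = i}" using c(1,2) by auto
    ultimately show ?thesis unfolding strictly_degenerate_def by blast
  qed
  then show ?thesis unfolding has_F_partition_def using c(3) by blast
qed

theorem theorem5:
  fixes V :: "'a set" and E :: "'a set set"
  assumes "planar_graph V E"
  shows "DPG_colorable V E 5 2
    \<and> choosable V E 5
    \<and> DP_k_colorable V E 5
    \<and> (\<forall>L i j l. k_assignment V 4 L \<longrightarrow> 0 < i \<longrightarrow> 0 < j \<longrightarrow> 0 < l \<longrightarrow>
          i \<noteq> j \<longrightarrow> i \<noteq> l \<longrightarrow> j \<noteq> l \<longrightarrow>
          (\<exists>c. L_forested_coloring V E L c \<and> independent_set E (color_class V c i)
               \<and> independent_set E (color_class V c j) \<and> independent_set E (color_class V c l)))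
    \<and> (\<forall>L i. k_assignment V 3 L \<longrightarrow> 0 < i \<longrightarrow>
          (\<exists>c. L_forested_coloring V E L c \<and> independent_set E (color_class V c i)))
    \<and> DP_vertex_arborable V E 3
    \<and> (\<forall>s F. s \<ge> 1 \<longrightarrow> (\<forall>v\<in>V. \<forall>i\<in>{1..s}. F i v \<le> 2) \<longrightarrow>
          (\<forall>v\<in>V. (\<Sum>i=1..s. F i v) \<ge> 5) \<longrightarrow> has_F_partition V E s F)"
proof (intro conjI allI impI)
  fix L and i j l :: nat
  assume "k_assignment V 4 L" "i \<noteq> j" "i \<noteq> l" "j \<noteq> l"
  then show "\<exists>c. L_forested_coloring V E L c \<and> independent_set E (color_class V c i)
     \<and> independent_set E (color_class V c j) \<and> independent_set E (color_class V c l)"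
    using planar_forested_coloring[OF assms, of 4 L "{i, j, l}"] by auto
next
  fix L and i :: nat
  assume "k_assignment V 3 L"
  then show "\<exists>c. L_forested_coloring V E L c \<and> independent_set E (color_class V c i)"
    using planar_forested_coloring[OF assms, of 3 L "{i}"] by auto
qed (use assms planar_DPG_colorable planar_5_choosable planar_DP_5_colorable planar_DP_3_arborable planar_F_partition in \<open>blast+\<close>)

end
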